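(* Let $\Omega\subset\mathbb{R}^n$ be a bounded domain, let $1<p<\infty$, and let $\mathcal{A}=\sum_{j=1}^nA_j(x)\partial_j+B(x)$ be an elliptic first order operator with $A_j,B\in C^\infty(\Omega,\mathcal{L}(E,F))$. Assume that $u\in W^{1,p}(\Omega,E)$ is weakly $L^p$-directionally differentiable at $x\in\Omega$, i.e. $$\frac{u(x+\varepsilon\xi)-u(x)}{\varepsilon}\rightharpoonup u'(x;\xi)\quad\text{weakly in }L^p(S^{n-1},E)\text{ as }\varepsilon\to0^+.$$ Then $$\lim_{\varepsilon\to0^+}\frac1{|B_\varepsilon(x)|}\int_{\partial B_\varepsilon(x)}\mathbb{A}(y,\nu(y))u(y)\,d\sigma(y)=\frac1{\omega_n}\int_{S^{n-1}}\mathbb{A}(x,\xi)u'(x;\xi)\,d\sigma(\xi)+\operatorname{div}\mathbb{A}(x)\,u(x).$$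
   Context: $E,F$ are finite-dimensional real Euclidean vector spaces, $\mathcal{L}(E,F)$ the linear maps $E\to F$. $\mathbb{A}(x,\xi)=\sum_j\xi_jA_j(x)$ is the principal symbol, $\operatorname{div}\mathbb{A}(x)=\sum_j\partial_jA_j(x)$. Elliptic means $\mathbb{A}(x,\xi)$ is injective for all $x\in\Omega$ and $\xi\ne0$. $\omega_n=|B_1(0)|$, $\sigma$ is surface measure, $\nu$ the outward unit normal of the ball $B_\varepsilon(x)$. Weak convergence in $L^p(S^{n-1},E)$ means convergence of the pairings $\int_{S^{n-1}}\langle\cdot,\phi(\xi)\rangle d\sigma(\xi)$ for every $\phi\in L^q(S^{n-1},E)$, $1/p+1/q=1$; $u'(x;\cdot)\in L^p(S^{n-1},E)$ is the weak limit, called the weak $L^p$ one-sided directional derivative of $u$ at $x$. *)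

theory Defs
  imports "HOL-Analysis.Analysis"
begin

definition partial_deriv :: "'n::finite \<Rightarrow> (real^'n \<Rightarrow> 'b::real_normed_vector) \<Rightarrow> real^'n \<Rightarrow> 'b" where
  "partial_deriv j f x = frechet_derivative f (at x) (axis j 1)"

text \<open>\<open>S\<close> is meant to be open: derivatives are taken in the full neighbourhood of each point.\<close>

primrec Ck_on :: "nat \<Rightarrow> (real^'n::finite) set \<Rightarrow> (real^'n \<Rightarrow> 'b::real_normed_vector) \<Rightarrow> bool" where
  "Ck_on 0 S f \<longleftrightarrow> continuous_on S f"
| "Ck_on (Suc k) S f \<longleftrightarrow> (\<forall>x\<in>S. f differentiable (at x)) \<and> (\<forall>j. Ck_on k S (partial_deriv j f))"

definition smooth_on :: "(real^'n::finite) set \<Rightarrow> (real^'n \<Rightarrow> 'b::real_normed_vector) \<Rightarrow> bool" where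
  "smooth_on S f \<longleftrightarrow> (\<forall>k. Ck_on k S f)"

text \<open>An operator \<open>\<Sum>j. A\<^sub>j(x) \<partial>\<^sub>j + B(x)\<close> is given by its coefficients
  \<open>A j x\<close> and \<open>B x\<close>. Since \<open>E\<close> and \<open>F\<close> are finite-dimensional, the type of bounded
  linear maps is the whole space \<open>L(E,F)\<close>.\<close>

definition symbol ::
    "('n::finite \<Rightarrow> real^'n \<Rightarrow> 'e::euclidean_space \<Rightarrow>\<^sub>L 'f::euclidean_space)
      \<Rightarrow> real^'n \<Rightarrow> real^'n \<Rightarrow> 'e \<Rightarrow>\<^sub>L 'f" where
  "symbol A x \<xi> = (\<Sum>j\<in>UNIV. (\<xi> $ j) *\<^sub>R A j x)"

definition div_symbol ::
    "('n::finite \<Rightarrow> real^'n \<Rightarrow> 'e::euclidean_space \<Rightarrow>\<^sub>L 'f::euclidean_space)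
      \<Rightarrow> real^'n \<Rightarrow> 'e \<Rightarrow>\<^sub>L 'f" where
  "div_symbol A x = (\<Sum>j\<in>UNIV. partial_deriv j (A j) x)"

definition elliptic_on ::
    "(real^'n::finite) set
      \<Rightarrow> ('n \<Rightarrow> real^'n \<Rightarrow> 'e::euclidean_space \<Rightarrow>\<^sub>L 'f::euclidean_space) \<Rightarrow> bool" where
  "elliptic_on \<Omega> A \<longleftrightarrow> (\<forall>x\<in>\<Omega>. \<forall>\<xi>. \<xi> \<noteq> 0 \<longrightarrow> inj (blinfun_apply (symbol A x \<xi>)))"

text \<open>Elements of function spaces are represented by genuine functions, not by classes
  modulo null sets.\<close>

definition in_Lp :: "'a measure \<Rightarrow> real \<Rightarrow> ('a \<Rightarrow> 'e::euclidean_space) \<Rightarrow> bool" where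
  "in_Lp M p f \<longleftrightarrow> f \<in> borel_measurable M \<and> integrable M (\<lambda>x. norm (f x) powr p)"

definition weakly_tendsto_Lp ::
    "'a measure \<Rightarrow> real \<Rightarrow> ('i \<Rightarrow> 'a \<Rightarrow> 'e::euclidean_space) \<Rightarrow> ('a \<Rightarrow> 'e) \<Rightarrow> 'i filter \<Rightarrow> bool" where
  "weakly_tendsto_Lp M p f g G \<longleftrightarrow>
     (\<forall>\<^sub>F i in G. in_Lp M p (f i)) \<and> in_Lp M p g \<and>
     (\<forall>q \<phi>. 1 / p + 1 / q = 1 \<longrightarrow> in_Lp M q \<phi> \<longrightarrow>
        ((\<lambda>i. \<integral>\<xi>. f i \<xi> \<bullet> \<phi> \<xi> \<partial>M) \<longlongrightarrow> (\<integral>\<xi>. g \<xi> \<bullet> \<phi> \<xi> \<partial>M)) G)"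

definition test_function :: "(real^'n::finite) set \<Rightarrow> (real^'n \<Rightarrow> real) \<Rightarrow> bool" where
  "test_function \<Omega> \<phi> \<longleftrightarrow> smooth_on UNIV \<phi> \<and>
     compact (closure {x. \<phi> x \<noteq> 0}) \<and> closure {x. \<phi> x \<noteq> 0} \<subseteq> \<Omega>"

definition weak_partial_deriv ::
    "(real^'n::finite) set \<Rightarrow> 'n \<Rightarrow> (real^'n \<Rightarrow> 'e::euclidean_space) \<Rightarrow> (real^'n \<Rightarrow> 'e) \<Rightarrow> bool" where
  "weak_partial_deriv \<Omega> j u g \<longleftrightarrow> (\<forall>\<phi>. test_function \<Omega> \<phi> \<longrightarrow>
     (\<integral>x. partial_deriv j \<phi> x *\<^sub>R u x \<partial>lebesgue_on \<Omega>) = - (\<integral>x. \<phi> x *\<^sub>R g x \<partial>lebesgue_on \<Omega>))"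

definition in_W1p ::
    "(real^'n::finite) set \<Rightarrow> real \<Rightarrow> (real^'n \<Rightarrow> 'e::euclidean_space) \<Rightarrow> bool" where
  "in_W1p \<Omega> p u \<longleftrightarrow> in_Lp (lebesgue_on \<Omega>) p u \<and>
     (\<forall>j. \<exists>g. in_Lp (lebesgue_on \<Omega>) p g \<and> weak_partial_deriv \<Omega> j u g)"

text \<open>For \<open>r > 0\<close> the surface measure of \<open>T \<subseteq> sphere c r\<close> is defined by the cone formula
  \<open>\<sigma>(T) = (n / r) * vol {y \<in> ball c r - {c}. c + r (y - c) / \<bar>y - c\<bar> \<in> T}\<close>, that is, as the
  image of Lebesgue measure under radial projection, normalised so that the solid cone over
  \<open>T\<close> with apex \<open>c\<close> has volume \<open>r \<sigma>(T) / n\<close>. It is completed, so that measurability on the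
  sphere is measurability modulo \<open>\<sigma>\<close>-null sets. In dimension 1 it is counting measure
  on \<open>{c - r, c + r}\<close>.\<close>

definition sphere_measure :: "'a::euclidean_space \<Rightarrow> real \<Rightarrow> 'a measure" where
  "sphere_measure c r = completion (scale_measure (ennreal (DIM('a) / r))
     (distr (restrict_space lborel (ball c r - {c})) (restrict_space borel (sphere c r))
        (\<lambda>y. c + (r / norm (y - c)) *\<^sub>R (y - c))))"

lemma radial_projection_measurable:
  fixes c :: "'a::euclidean_space"
  assumes "0 < r"
  shows "(\<lambda>y. c + (r / norm (y - c)) *\<^sub>R (y - c)) \<in>
    restrict_space lborel (ball c r - {c}) \<rightarrow>\<^sub>M restrict_space borel (sphere c r)"
proof (rule measurable_restrict_space2)
  show "(\<lambda>y. c + (r / norm (y - c)) *\<^sub>R (y - c)) \<in>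
      space (restrict_space lborel (ball c r - {c})) \<rightarrow> sphere c r"
    using assms by (auto simp: space_restrict_space dist_norm)
  show "(\<lambda>y. c + (r / norm (y - c)) *\<^sub>R (y - c)) \<in>
      restrict_space lborel (ball c r - {c}) \<rightarrow>\<^sub>M borel"
    by (rule measurable_restrict_space1) measurable
qed

lemma emeasure_sphere_measure:
  fixes c :: "'a::euclidean_space"
  assumes "0 < r" and T: "T \<in> sets borel" "T \<subseteq> sphere c r"
  shows "emeasure (sphere_measure c r) T =
    ennreal (DIM('a) / r) *
      emeasure lborel {y \<in> ball c r - {c}. c + (r / norm (y - c)) *\<^sub>R (y - c) \<in> T}"
proof -
  let ?L = "restrict_space lborel (ball c r - {c})"
  let ?S = "restrict_space borel (sphere c r)"
  let ?f = "\<lambda>y. c + (r / norm (y - c)) *\<^sub>R (y - c)"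
  have TS: "T \<in> sets ?S"
    using T by (auto simp: sets_restrict_space)
  have "emeasure (sphere_measure c r) T = ennreal (DIM('a) / r) * emeasure (distr ?L ?S ?f) T"
    unfolding sphere_measure_def using TS by (subst emeasure_completion) auto
  also have "emeasure (distr ?L ?S ?f) T = emeasure ?L (?f -` T \<inter> space ?L)"
    by (rule emeasure_distr[OF radial_projection_measurable[OF \<open>0 < r\<close>] TS])
  also have "?f -` T \<inter> space ?L = {y \<in> ball c r - {c}. ?f y \<in> T}"
    by (auto simp: space_restrict_space)
  also have "emeasure ?L \<dots> = emeasure lborel {y \<in> ball c r - {c}. ?f y \<in> T}"
    by (rule emeasure_restrict_space) auto
  finally show ?thesis .
qed

definition outward_unit_normal :: "real^'n::finite \<Rightarrow> real \<Rightarrow> real^'n \<Rightarrow> real^'n" where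
  "outward_unit_normal c r y = (1 / r) *\<^sub>R (y - c)"

text \<open>The values of \<open>u\<close> at \<open>x\<close> and on the small spheres around \<open>x\<close> are those of the given
  representative \<open>u\<close>, which is arbitrary. An element of \<open>W\<^bsup>1,p\<^esup>\<close> has representatives whose
  restrictions to all small spheres around \<open>x\<close> are its traces.\<close>

definition weak_Lp_directional_deriv ::
    "real \<Rightarrow> (real^'n::finite \<Rightarrow> 'e::euclidean_space) \<Rightarrow> real^'n \<Rightarrow> (real^'n \<Rightarrow> 'e) \<Rightarrow> bool" where
  "weak_Lp_directional_deriv p u x u' \<longleftrightarrow>
     weakly_tendsto_Lp (sphere_measure 0 1) p
       (\<lambda>\<epsilon> \<xi>. (1 / \<epsilon>) *\<^sub>R (u (x + \<epsilon> *\<^sub>R \<xi>) - u x)) u' (at_right 0)"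

end

theory Submission
  imports Defs
begin

text \<open>
  Rescaling the sphere of radius \<open>\<epsilon>\<close> around \<open>x\<close> to the unit sphere \<open>S\<close>, with surface measure
  \<open>\<sigma>\<close>, turns the average into \<open>1 / \<omega>\<^sub>n\<close> times the integral over \<open>S\<close> of
  \<open>A(x + \<epsilon> \<xi>, \<xi>) u(x + \<epsilon> \<xi>) / \<epsilon>\<close>, where \<open>\<omega>\<^sub>n\<close> is the volume of the unit ball. Splitting \<open>u (x + \<epsilon> \<xi>)\<close> into \<open>u x\<close> and \<open>\<epsilon>\<close> times the difference quotient \<open>w\<^sub>\<epsilon>(\<xi>)\<close> gives two
  terms (lemma \<open>ball_average_flux_eq\<close>), which converge for different reasons.

  In the integral of \<open>A(x + \<epsilon> \<xi>, \<xi>) w\<^sub>\<epsilon>(\<xi>)\<close> the first factor converges uniformly and the second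
  weakly. Such a product converges because a weakly convergent sequence is bounded in the dual
  of the continuous functions, by the uniform boundedness principle
  (\<open>uniform_boundedness\<close>, \<open>weakly_tendsto_Lp_apply_uniform_limit\<close>,
  \<open>symbol_integral_weak_tendsto\<close>). The limit is the integral of \<open>A(x, \<xi>) u'(\<xi>)\<close>.

  The integral of \<open>A(x + \<epsilon> \<xi>, \<xi>) u(x) / \<epsilon>\<close> is the flux of smooth vector fields through a small
  sphere, divided by the radius. A first-order Taylor expansion reduces it to moments of \<open>\<sigma>\<close>: the
  first moments vanish and the second moments \<open>\<integral> \<xi>\<^sub>i \<xi>\<^sub>j d\<sigma>\<close> are \<open>\<omega>\<^sub>n\<close> for \<open>i = j\<close> and \<open>0\<close>
  otherwise, so the limit is \<open>\<omega>\<^sub>n\<close> times the divergence of the symbol, applied to \<open>u x\<close>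
  (\<open>integral_unit_sphere_coordinate_product\<close>, \<open>symbol_flux_tendsto_div_symbol\<close>).

  The rescaling and the moments both rest on \<open>integral_sphere_measure_similarity\<close>, the
  transformation of surface measure under similarities, which the cone formula reduces to
  Lebesgue measure.
\<close>

section \<open>Surface measure under similarities\<close>

text \<open>The surface measure before completion. Its measurable sets are the Borel subsets of the
  sphere, so images under similarities can be computed there from Lebesgue measure; statements
  about the completed measure then follow by splitting a measurable set into a Borel part and
  a subset of a Borel null set.\<close>

definition cone_measure :: "real^'n::finite \<Rightarrow> real \<Rightarrow> (real^'n) measure" where
  "cone_measure c r = scale_measure (ennreal (DIM(real^'n) / r))
     (distr (restrict_space lborel (ball c r - {c})) (restrict_space borel (sphere c r))
        (\<lambda>y. c + (r / norm (y - c)) *\<^sub>R (y - c)))"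

lemma sphere_measure_eq_completion: "sphere_measure c r = completion (cone_measure c r)"
  by (simp add: sphere_measure_def cone_measure_def)

lemma sets_cone_measure: "sets (cone_measure c r) = sets (restrict_space borel (sphere c r))"
  by (simp add: cone_measure_def)

lemma sets_cone_measure_iff: "T \<in> sets (cone_measure c r) \<longleftrightarrow> T \<in> sets borel \<and> T \<subseteq> sphere c r"
  by (auto simp: sets_cone_measure sets_restrict_space_iff)

lemma space_cone_measure [simp]: "space (cone_measure c r) = sphere c r"
  by (simp add: cone_measure_def space_scale_measure space_restrict_space)

lemma space_sphere_measure [simp]: "space (sphere_measure c r) = sphere c (r :: real)"
  for c :: "real^'n::finite"
  by (simp add: sphere_measure_eq_completion)

lemma emeasure_cone_measure:
  "T \<in> sets (cone_measure c r) \<Longrightarrow> emeasure (sphere_measure c r) T = emeasure (cone_measure c r) T"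
  by (simp add: sphere_measure_eq_completion)

lemma ident_measurable_sphere_measure: "(\<lambda>x. x) \<in> sphere_measure c r \<rightarrow>\<^sub>M borel"
  for c :: "real^'n::finite"
  unfolding sphere_measure_eq_completion
  by (rule measurable_completion) (auto simp: measurable_def sets_cone_measure_iff Int_commute)

lemma continuous_on_imp_measurable_sphere_measure:
  fixes f :: "real^'n::finite \<Rightarrow> 'b::topological_space"
  assumes "continuous_on (sphere c r) f"
  shows "f \<in> borel_measurable (sphere_measure c r)"
proof -
  have "f \<in> borel_measurable (restrict_space borel (sphere c r))"
    using assms by (rule borel_measurable_continuous_on_restrict)
  then have "f \<in> borel_measurable (cone_measure c r)"
    by (simp cong: measurable_cong_sets add: sets_cone_measure)
  then show ?thesis
    unfolding sphere_measure_eq_completion by (rule measurable_completion)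
qed

definition solid_cone :: "real^'n::finite \<Rightarrow> real \<Rightarrow> (real^'n) set \<Rightarrow> (real^'n) set" where
  "solid_cone c r T = {y \<in> ball c r - {c}. c + (r / norm (y - c)) *\<^sub>R (y - c) \<in> T}"

lemma solid_cone_borel:
  assumes "T \<in> sets borel"
  shows "solid_cone c r T \<in> sets borel"
proof -
  have "(\<lambda>y. c + (r / norm (y - c)) *\<^sub>R (y - c)) \<in> borel_measurable borel"
    by measurable
  from measurable_sets[OF this assms]
  have "(\<lambda>y. c + (r / norm (y - c)) *\<^sub>R (y - c)) -` T \<in> sets borel" by simp
  then have "(ball c r - {c}) \<inter> (\<lambda>y. c + (r / norm (y - c)) *\<^sub>R (y - c)) -` T \<in> sets borel"
    by auto
  also have "(ball c r - {c}) \<inter> (\<lambda>y. c + (r / norm (y - c)) *\<^sub>R (y - c)) -` T = solid_cone c r T"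
    by (auto simp: solid_cone_def)
  finally show ?thesis .
qed

text \<open>Radial projection commutes with similarities. Hence a similarity maps the solid cone over
  the preimage of \<open>T\<close> onto the solid cone over \<open>T\<close>, and the behaviour of surface measure under
  similarities is that of Lebesgue measure.\<close>

lemma solid_cone_similarity:
  fixes Q :: "real^'n::finite \<Rightarrow> real^'n"
  assumes Q: "orthogonal_transformation Q" and s: "0 < s" and r: "0 < r"
  shows "solid_cone c' (s * r) T =
    (\<lambda>y. c' + s *\<^sub>R Q (y - c)) ` solid_cone c r ((\<lambda>y. c' + s *\<^sub>R Q (y - c)) -` T \<inter> sphere c r)"
proof -
  have lin: "linear Q" using Q by (rule orthogonal_transformation_linear)
  have nQ: "norm (Q v) = norm v" for v using Q by (rule orthogonal_transformation_norm)
  have mem: "c' + s *\<^sub>R Q (z - c) \<in> solid_cone c' (s * r) T \<longleftrightarrow>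
      z \<in> solid_cone c r ((\<lambda>y. c' + s *\<^sub>R Q (y - c)) -` T \<inter> sphere c r)" for z
  proof (cases "z = c")
    case True
    then show ?thesis by (simp add: solid_cone_def linear_0[OF lin])
  next
    case False
    then have "Q (z - c) \<noteq> 0" by (metis nQ norm_eq_zero right_minus_eq)
    moreover have "s *\<^sub>R Q ((r / norm (z - c)) *\<^sub>R (z - c)) =
        (s * r / norm (s *\<^sub>R Q (z - c))) *\<^sub>R (s *\<^sub>R Q (z - c))"
      using s by (simp add: linear_cmul[OF lin] nQ mult.commute del: scaleR_right_diff_distrib)
    moreover have "dist c' (c' + s *\<^sub>R Q (z - c)) < s * r \<longleftrightarrow> dist c z < r"
      using s by (simp add: dist_norm nQ norm_minus_commute)
    ultimately show ?thesis
      using s r False by (simp add: solid_cone_def dist_norm)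
  qed
  have surj: "\<exists>z. y = c' + s *\<^sub>R Q (z - c)" for y
  proof -
    obtain w where "Q w = (1/s) *\<^sub>R (y - c')"
      using orthogonal_transformation_surj[OF Q] by (metis surjD)
    then have "y = c' + s *\<^sub>R Q ((w + c) - c)" using s by simp
    then show ?thesis by blast
  qed
  show ?thesis
  proof (intro equalityI subsetI)
    fix y assume y: "y \<in> solid_cone c' (s * r) T"
    obtain z where z: "y = c' + s *\<^sub>R Q (z - c)" using surj[of y] ..
    show "y \<in> (\<lambda>y. c' + s *\<^sub>R Q (y - c)) ` solid_cone c r ((\<lambda>y. c' + s *\<^sub>R Q (y - c)) -` T \<inter> sphere c r)"
      using y mem[of z] unfolding z by (rule_tac x = z in image_eqI) simp_all
  qed (auto simp: mem)
qed

lemma orthogonal_transformation_borel_measurable: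
  fixes Q :: "'a::euclidean_space \<Rightarrow> 'a"
  assumes "orthogonal_transformation Q"
  shows "Q \<in> borel_measurable borel"
  by (intro borel_measurable_continuous_onI linear_continuous_on)
     (simp add: linear_conv_bounded_linear[symmetric] orthogonal_transformation_linear assms)

text \<open>Invariance of Lebesgue measure is included in the notion because the isometries of
  interest are the identity and the reflections and swaps of coordinates, for which it is read
  off from boxes.\<close>

definition lebesgue_isometry :: "('a::euclidean_space \<Rightarrow> 'a) \<Rightarrow> bool" where
  "lebesgue_isometry Q \<longleftrightarrow> orthogonal_transformation Q \<and> distr lborel borel Q = lborel"

lemma lebesgue_isometry_measurable: "lebesgue_isometry Q \<Longrightarrow> Q \<in> borel_measurable borel"
  unfolding lebesgue_isometry_def by (simp add: orthogonal_transformation_borel_measurable)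

lemma lebesgue_isometry_inv:
  assumes Q: "lebesgue_isometry Q"
  shows "lebesgue_isometry (inv Q)"
proof -
  have o: "orthogonal_transformation Q" using Q by (simp add: lebesgue_isometry_def)
  then have oi: "orthogonal_transformation (inv Q)" by (rule orthogonal_transformation_inv)
  have m: "inv Q \<in> borel_measurable borel"
    using oi by (rule orthogonal_transformation_borel_measurable)
  have "distr lborel borel (inv Q) = distr (distr lborel borel Q) borel (inv Q)"
    using Q by (simp add: lebesgue_isometry_def)
  also have "\<dots> = distr lborel borel (inv Q \<circ> Q)"
    using m lebesgue_isometry_measurable[OF Q] by (intro distr_distr) auto
  also have "inv Q \<circ> Q = (\<lambda>x. x)"
    using orthogonal_transformation_inj[OF o] by (simp add: fun_eq_iff)
  also have "distr lborel borel (\<lambda>x. x) = (lborel :: 'a measure)"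
    by (rule distr_id2) simp
  finally show ?thesis using oi by (simp add: lebesgue_isometry_def)
qed

lemma lebesgue_isometry_id: "lebesgue_isometry (\<lambda>x. x)"
  by (simp add: lebesgue_isometry_def orthogonal_transformation_def distr_id2 linear_iff)

lemma emeasure_similarity_image:
  fixes S :: "(real^'n::finite) set" and Q :: "real^'n \<Rightarrow> real^'n"
  assumes Q: "lebesgue_isometry Q" and s: "0 < s" and S: "S \<in> sets borel"
  shows "emeasure lebesgue ((\<lambda>y. c' + s *\<^sub>R Q (y - c)) ` S) = ennreal (s ^ CARD('n)) * emeasure lborel S"
proof -
  have oQ: "orthogonal_transformation Q" using Q by (simp add: lebesgue_isometry_def)
  have lin: "linear Q" using oQ by (rule orthogonal_transformation_linear)
  have bij: "bij Q" using oQ by (rule orthogonal_transformation_bij)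
  note mi = lebesgue_isometry_measurable[OF lebesgue_isometry_inv[OF Q]]
  have "(\<lambda>y. c' + s *\<^sub>R Q (y - c)) ` S = (\<lambda>y. s *\<^sub>R y + (c' - s *\<^sub>R Q c)) ` (Q ` S)"
    by (simp add: image_image linear_diff[OF lin] algebra_simps)
  then have "emeasure lebesgue ((\<lambda>y. c' + s *\<^sub>R Q (y - c)) ` S)
      = ennreal (s ^ CARD('n)) * emeasure lebesgue (Q ` S)"
    using emeasure_lebesgue_affine[of s "c' - s *\<^sub>R Q c" "Q ` S"] s
    by (simp add: ennreal_power)
  also have QS: "Q ` S = inv Q -` S" by (rule bij_image_Collect_eq[OF bij, of "\<lambda>x. x \<in> S", simplified, folded vimage_def])
  also have "emeasure lebesgue (inv Q -` S) = emeasure lborel (inv Q -` S)"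
    using measurable_sets[OF mi S] by simp
  also have "\<dots> = emeasure (distr lborel borel (inv Q)) S"
    using mi S by (simp add: emeasure_distr)
  also have "\<dots> = emeasure lborel S"
    using lebesgue_isometry_inv[OF Q] by (simp add: lebesgue_isometry_def)
  finally show ?thesis .
qed

text \<open>The cone volume is multiplied by \<open>s ^ n\<close> and the normalising factor \<open>n / r\<close> is divided by
  \<open>s\<close>; together they leave \<open>s ^ (n - 1)\<close>.\<close>

lemma emeasure_sphere_measure_similarity:
  fixes c c' :: "real^'n::finite"
  assumes Q: "lebesgue_isometry Q" and s: "0 < s" and r: "0 < r"
    and T: "T \<in> sets (cone_measure c' (s * r))"
  defines "g \<equiv> \<lambda>y. c' + s *\<^sub>R Q (y - c)"
  shows "g -` T \<inter> sphere c r \<in> sets (cone_measure c r)"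
    and "emeasure (cone_measure c' (s * r)) T =
      ennreal (s ^ (CARD('n) - 1)) * emeasure (cone_measure c r) (g -` T \<inter> sphere c r)"
proof -
  have oQ: "orthogonal_transformation Q" using Q by (simp add: lebesgue_isometry_def)
  have lin: "linear Q" using oQ by (rule orthogonal_transformation_linear)
  have T': "T \<in> sets borel" "T \<subseteq> sphere c' (s * r)" using T by (auto simp: sets_cone_measure_iff)
  have "continuous_on UNIV g"
    unfolding g_def
    by (intro continuous_intros linear_continuous_on_compose[OF _ lin])
  then have "g \<in> borel_measurable borel" by (rule borel_measurable_continuous_onI)
  from measurable_sets[OF this T'(1)] have gT: "g -` T \<inter> sphere c r \<in> sets borel" by auto
  then show gT': "g -` T \<inter> sphere c r \<in> sets (cone_measure c r)" by (simp add: sets_cone_measure_iff)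
  have "emeasure (cone_measure c' (s * r)) T
      = ennreal (CARD('n) / (s * r)) * emeasure lborel (solid_cone c' (s * r) T)"
    unfolding emeasure_cone_measure[OF T, symmetric] emeasure_sphere_measure[OF mult_pos_pos[OF s r] T']
    by (simp add: solid_cone_def)
  also have "emeasure lborel (solid_cone c' (s * r) T) = emeasure lebesgue (solid_cone c' (s * r) T)"
    using solid_cone_borel[OF T'(1)] by simp
  also have "\<dots> = ennreal (s ^ CARD('n)) * emeasure lborel (solid_cone c r (g -` T \<inter> sphere c r))"
    unfolding solid_cone_similarity[OF oQ s r, of c' T c] g_def
    using gT[unfolded g_def] by (intro emeasure_similarity_image Q s solid_cone_borel)
  also have "ennreal (CARD('n) / (s * r)) *
        (ennreal (s ^ CARD('n)) * emeasure lborel (solid_cone c r (g -` T \<inter> sphere c r)))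
      = ennreal (s ^ (CARD('n) - 1)) * (ennreal (CARD('n) / r) *
         emeasure lborel (solid_cone c r (g -` T \<inter> sphere c r)))"
  proof -
    have "s ^ CARD('n) = s * s ^ (CARD('n) - 1)"
      by (metis zero_less_card_finite power_eq_if less_numeral_extra(3))
    then have "CARD('n) / (s * r) * s ^ CARD('n) = s ^ (CARD('n) - 1) * (CARD('n) / r)"
      using s by simp
    then have "ennreal (CARD('n) / (s * r)) * ennreal (s ^ CARD('n))
        = ennreal (s ^ (CARD('n) - 1)) * ennreal (CARD('n) / r)"
      using s r by (subst (1 2) ennreal_mult[symmetric]) auto
    then show ?thesis by (metis mult.assoc)
  qed
  also have "ennreal (CARD('n) / r) * emeasure lborel (solid_cone c r (g -` T \<inter> sphere c r))
      = emeasure (cone_measure c r) (g -` T \<inter> sphere c r)"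
    unfolding emeasure_cone_measure[OF gT', symmetric] emeasure_sphere_measure[OF r gT Int_lower2]
    by (simp add: solid_cone_def)
  finally show "emeasure (cone_measure c' (s * r)) T =
      ennreal (s ^ (CARD('n) - 1)) * emeasure (cone_measure c r) (g -` T \<inter> sphere c r)" .
qed

lemma complete_sphere_measure: "complete_measure (sphere_measure c r)" for c :: "real^'n::finite"
  unfolding sphere_measure_eq_completion by (rule completion.complete_measure_axioms)

lemma similarity_into_cone_measure:
  fixes c c' :: "real^'n::finite"
  assumes Q: "lebesgue_isometry Q" and s: "0 < s" and r: "0 < r"
  shows "(\<lambda>y. c' + s *\<^sub>R Q (y - c)) \<in> sphere_measure c r \<rightarrow>\<^sub>M cone_measure c' (s * r)"
proof (rule measurableI)
  have oQ: "orthogonal_transformation Q" using Q by (simp add: lebesgue_isometry_def)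
  fix y assume "y \<in> space (sphere_measure c r)"
  then show "c' + s *\<^sub>R Q (y - c) \<in> space (cone_measure c' (s * r))"
    using s orthogonal_transformation_norm[OF oQ]
    by (simp add: dist_norm norm_minus_commute)
next
  fix T assume "T \<in> sets (cone_measure c' (s * r))"
  from emeasure_sphere_measure_similarity(1)[OF Q s r this]
  show "(\<lambda>y. c' + s *\<^sub>R Q (y - c)) -` T \<inter> space (sphere_measure c r) \<in> sets (sphere_measure c r)"
    by (simp add: sphere_measure_eq_completion)
qed

lemma similarity_null_sets:
  fixes c c' :: "real^'n::finite"
  assumes Q: "lebesgue_isometry Q" and s: "0 < s" and r: "0 < r"
    and N: "N \<in> null_sets (cone_measure c' (s * r))"
  shows "(\<lambda>y. c' + s *\<^sub>R Q (y - c)) -` N \<inter> sphere c r \<in> null_sets (cone_measure c r)"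
proof -
  from N have N': "N \<in> sets (cone_measure c' (s * r))" "emeasure (cone_measure c' (s * r)) N = 0"
    by (auto simp: null_sets_def)
  have "ennreal (s ^ (CARD('n) - 1)) \<noteq> 0" using s by simp
  then show ?thesis
    using emeasure_sphere_measure_similarity[OF Q s r N'(1), of c] N'(2)
    by (simp add: null_sets_def)
qed

text \<open>Measurability for the completed measures: preimages of null sets are null.\<close>

lemma similarity_measurable:
  fixes c c' :: "real^'n::finite"
  assumes Q: "lebesgue_isometry Q" and s: "0 < s" and r: "0 < r"
  shows "(\<lambda>y. c' + s *\<^sub>R Q (y - c)) \<in> sphere_measure c r \<rightarrow>\<^sub>M sphere_measure c' (s * r)"
proof -
  interpret complete_measure "sphere_measure c r" by (rule complete_sphere_measure)
  show ?thesis
    unfolding sphere_measure_eq_completion[of c']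
  proof (rule measurable_completion2[OF similarity_into_cone_measure[OF assms]], rule subsetI)
    fix N assume N: "N \<in> null_sets (cone_measure c' (s * r))"
    then show "N \<in> null_sets (distr (sphere_measure c r) (cone_measure c' (s * r)) (\<lambda>y. c' + s *\<^sub>R Q (y - c)))"
      using similarity_null_sets[OF assms N, of c] similarity_into_cone_measure[OF assms, of c' c]
      by (auto simp: null_sets_def emeasure_distr emeasure_cone_measure)
  qed
qed

lemma sphere_measure_similarity:
  fixes c c' :: "real^'n::finite"
  assumes Q: "lebesgue_isometry Q" and s: "0 < s" and r: "0 < r"
  defines "g \<equiv> \<lambda>y. c' + s *\<^sub>R Q (y - c)"
  shows "sphere_measure c' (s * r) =
    density (distr (sphere_measure c r) (sphere_measure c' (s * r)) g) (\<lambda>_. ennreal (s ^ (CARD('n) - 1)))"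
    (is "?S = density ?D _")
proof (rule measure_eqI)
  show "sets ?S = sets (density ?D (\<lambda>_. ennreal (s ^ (CARD('n) - 1))))" by simp
  fix T assume T: "T \<in> sets ?S"
  let ?N = "cone_measure c' (s * r)"
  let ?M = "main_part ?N T" and ?Z = "null_part ?N T"
  have T': "T \<in> sets (completion ?N)" using T by (simp add: sphere_measure_eq_completion)
  obtain Z where Z: "Z \<in> null_sets ?N" "?Z \<subseteq> Z" using null_part[OF T'] by auto
  have g: "g \<in> sphere_measure c r \<rightarrow>\<^sub>M ?S" unfolding g_def by (rule similarity_measurable[OF Q s r])
  have M: "?M \<in> sets ?N" using T' by simp
  have pre: "g -` T \<inter> sphere c r = (g -` ?M \<inter> sphere c r) \<union> (g -` ?Z \<inter> sphere c r)"
    using main_part_null_part_Un[OF T'] by auto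
  have nullZ: "g -` ?Z \<inter> sphere c r \<in> null_sets (sphere_measure c r)"
    unfolding sphere_measure_eq_completion
    by (rule null_sets_completion_subset
       [OF _ null_sets_completionI[OF similarity_null_sets[OF Q s r Z(1), of c]]])
       (use Z(2) in \<open>auto simp: g_def\<close>)
  have "emeasure ?S T = emeasure ?N ?M"
    using T' by (simp add: sphere_measure_eq_completion)
  also have "\<dots> = ennreal (s ^ (CARD('n) - 1)) * emeasure (cone_measure c r) (g -` ?M \<inter> sphere c r)"
    unfolding g_def by (rule emeasure_sphere_measure_similarity(2)[OF Q s r M])
  also have "emeasure (cone_measure c r) (g -` ?M \<inter> sphere c r)
      = emeasure (sphere_measure c r) (g -` ?M \<inter> sphere c r)"
    using emeasure_sphere_measure_similarity(1)[OF Q s r M] by (simp add: emeasure_cone_measure g_def)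
  also have "\<dots> = emeasure (sphere_measure c r) (g -` T \<inter> sphere c r)"
    unfolding pre
    by (rule emeasure_Un_null_set[OF _ nullZ, symmetric])
      (use emeasure_sphere_measure_similarity(1)[OF Q s r M, of c] in
        \<open>auto simp: sphere_measure_eq_completion g_def\<close>)
  also have "\<dots> = emeasure ?D T"
    using emeasure_distr[OF g T] by simp
  finally show "emeasure ?S T = emeasure (density ?D (\<lambda>_. ennreal (s ^ (CARD('n) - 1)))) T"
    using T by (simp add: emeasure_density_const)
qed

text \<open>The formula serves twice: with \<open>Q\<close> the identity it rescales an integral over a small sphere
  to the unit sphere, and with \<open>s = 1\<close> it gives the symmetries of the unit sphere. Measurability is
  only asked of the pulled-back function; that of \<open>f\<close> on the target sphere follows because the
  inverse of a similarity is a similarity.\<close>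

lemma integral_sphere_measure_similarity:
  fixes c c' :: "real^'n::finite" and f :: "real^'n \<Rightarrow> 'b::{banach, second_countable_topology}"
  assumes Q: "lebesgue_isometry Q" and s: "0 < s" and r: "0 < r"
    and f: "(\<lambda>y. f (c' + s *\<^sub>R Q (y - c))) \<in> borel_measurable (sphere_measure c r)"
  shows "(\<integral>y. f y \<partial>sphere_measure c' (s * r)) =
    s ^ (CARD('n) - 1) *\<^sub>R (\<integral>y. f (c' + s *\<^sub>R Q (y - c)) \<partial>sphere_measure c r)"
proof -
  let ?S = "sphere_measure c' (s * r)"
  let ?g = "\<lambda>y. c' + s *\<^sub>R Q (y - c)"
  let ?D = "distr (sphere_measure c r) ?S ?g"
  have oQ: "orthogonal_transformation Q" using Q by (simp add: lebesgue_isometry_def)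
  have surj: "Q (inv Q v) = v" for v
    using orthogonal_transformation_surj[OF oQ] by (rule surj_f_inv_f)
  have Qi: "lebesgue_isometry (inv Q)" using Q by (rule lebesgue_isometry_inv)
  have cmul: "inv Q (a *\<^sub>R v) = a *\<^sub>R inv Q v" "Q (a *\<^sub>R v) = a *\<^sub>R Q v" for a v
    by (auto intro: linear_cmul orthogonal_transformation_linear oQ orthogonal_transformation_inv)
  \<comment> \<open>\<open>f\<close> is the pulled-back function composed with the inverse similarity.\<close>
  have fS: "f \<in> borel_measurable ?S"
  proof -
    have "(\<lambda>z. c + (1/s) *\<^sub>R inv Q (z - c')) \<in> ?S \<rightarrow>\<^sub>M sphere_measure c r"
      using similarity_measurable[OF Qi, of "1/s" "s * r" c c'] s r by simp
    from measurable_compose[OF this f] show ?thesis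
      using s by (simp add: cmul surj)
  qed
  have "(\<integral>y. f y \<partial>?S) = (\<integral>y. f y \<partial>density ?D (\<lambda>_. ennreal (s ^ (CARD('n) - 1))))"
    by (subst sphere_measure_similarity[OF Q s r, of c' c]) simp
  also have "\<dots> = (\<integral>y. s ^ (CARD('n) - 1) *\<^sub>R f y \<partial>?D)"
    using s fS by (intro integral_density) auto
  also have "\<dots> = s ^ (CARD('n) - 1) *\<^sub>R (\<integral>y. f y \<partial>?D)" by simp
  also have "(\<integral>y. f y \<partial>?D) = (\<integral>y. f (?g y) \<partial>sphere_measure c r)"
    by (rule integral_distr[OF similarity_measurable[OF Q s r] fS])
  finally show ?thesis .
qed

section \<open>Moments of surface measure on the unit sphere\<close>

text \<open>Lebesgue measure is determined by its values on boxes.\<close>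

lemma lebesgue_isometryI_box:
  fixes Q :: "real^'n::finite \<Rightarrow> real^'n"
  assumes Q: "orthogonal_transformation Q"
    and box: "\<And>l u. (\<And>i. l $ i \<le> u $ i) \<Longrightarrow> \<exists>l' u'. Q -` box l u = box l' u' \<and> (\<forall>i. l' $ i \<le> u' $ i) \<and>
        (\<Prod>i\<in>UNIV. u' $ i - l' $ i) = (\<Prod>i\<in>UNIV. u $ i - l $ i)"
  shows "lebesgue_isometry Q"
proof -
  have m: "Q \<in> borel_measurable borel"
    using Q by (rule orthogonal_transformation_borel_measurable)
  have pb: "(\<Prod>b\<in>Basis. (u - l) \<bullet> b) = (\<Prod>i\<in>UNIV. u $ i - l $ i)" for u l :: "real^'n"
    by (simp add: Basis_vec_def UNION_singleton_eq_range prod.reindex inj_on_def axis_eq_axis inner_axis)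
  have "lborel = distr lborel borel Q"
  proof (rule lborel_eqI)
    fix l u :: "real^'n" assume lu: "\<And>b. b \<in> Basis \<Longrightarrow> l \<bullet> b \<le> u \<bullet> b"
    then have le: "l $ i \<le> u $ i" for i
      using lu[of "axis i 1"] by (auto simp: Basis_vec_def inner_axis)
    obtain l' u' where b: "Q -` box l u = box l' u'" and le': "\<And>i. l' $ i \<le> u' $ i"
      and e: "(\<Prod>i\<in>UNIV. u' $ i - l' $ i) = (\<Prod>i\<in>UNIV. u $ i - l $ i)"
      using box[OF le] by blast
    have "emeasure (distr lborel borel Q) (box l u) = emeasure lborel (box l' u')"
      using m by (simp add: emeasure_distr b)
    also have "\<dots> = ennreal (\<Prod>b\<in>Basis. (u' - l') \<bullet> b)"
      by (rule emeasure_lborel_box) (use le' in \<open>auto simp: Basis_vec_def inner_axis\<close>)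
    also have "\<dots> = ennreal (\<Prod>b\<in>Basis. (u - l) \<bullet> b)" unfolding pb e ..
    finally show "emeasure (distr lborel borel Q) (box l u) = ennreal (\<Prod>b\<in>Basis. (u - l) \<bullet> b)" .
  qed simp
  then show ?thesis using Q by (simp add: lebesgue_isometry_def)
qed

lemma lebesgue_isometry_reflect_coordinate:
  "lebesgue_isometry (\<lambda>x::real^'n::finite. \<chi> k. if k = i then - x $ k else x $ k)"
proof (rule lebesgue_isometryI_box)
  show "orthogonal_transformation (\<lambda>x::real^'n. \<chi> k. if k = i then - x $ k else x $ k)"
    by (auto simp: orthogonal_transformation_def inner_vec_def vec_eq_iff linear_iff intro!: sum.cong)
  fix l u :: "real^'n" assume le: "\<And>i. l $ i \<le> u $ i"
  let ?l = "\<chi> k. if k = i then - u $ k else l $ k" and ?u = "\<chi> k. if k = i then - l $ k else u $ k"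
  have "(\<lambda>x::real^'n. \<chi> k. if k = i then - x $ k else x $ k) -` box l u = box ?l ?u"
    by (auto simp: mem_box_cart split: if_splits) (metis minus_less_iff less_minus_iff)+
  moreover have "(\<Prod>k\<in>UNIV. ?u $ k - ?l $ k) = (\<Prod>k\<in>UNIV. u $ k - l $ k)"
    by (intro prod.cong) auto
  ultimately show "\<exists>l' u'. (\<lambda>x::real^'n. \<chi> k. if k = i then - x $ k else x $ k) -` box l u = box l' u' \<and>
      (\<forall>i. l' $ i \<le> u' $ i) \<and> (\<Prod>i\<in>UNIV. u' $ i - l' $ i) = (\<Prod>i\<in>UNIV. u $ i - l $ i)"
    using le by (intro exI[of _ ?l] exI[of _ ?u]) auto
qed

lemma lebesgue_isometry_swap_coordinates:
  "lebesgue_isometry (\<lambda>x::real^'n::finite. \<chi> k. x $ Transposition.transpose i j k)"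
proof (rule lebesgue_isometryI_box)
  let ?t = "Transposition.transpose i j"
  have bij: "bij ?t" by simp
  show "orthogonal_transformation (\<lambda>x::real^'n. \<chi> k. x $ ?t k)"
    unfolding orthogonal_transformation_def
    by (auto simp: inner_vec_def linear_iff vec_eq_iff intro!: sum.reindex_bij_betw[OF bij])
  fix l u :: "real^'n" assume le: "\<And>i. l $ i \<le> u $ i"
  let ?l = "\<chi> k. l $ ?t k" and ?u = "\<chi> k. u $ ?t k"
  have "(\<lambda>x::real^'n. \<chi> k. x $ ?t k) -` box l u = box ?l ?u"
  proof (rule set_eqI)
    fix x
    have "(\<forall>k. l $ k < x $ ?t k \<and> x $ ?t k < u $ k) \<longleftrightarrow> (\<forall>k. l $ ?t k < x $ k \<and> x $ k < u $ ?t k)"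
      by (metis transpose_involutory)
    then show "x \<in> (\<lambda>x::real^'n. \<chi> k. x $ ?t k) -` box l u \<longleftrightarrow> x \<in> box ?l ?u"
      by (simp add: mem_box_cart)
  qed
  moreover have "(\<Prod>k\<in>UNIV. ?u $ k - ?l $ k) = (\<Prod>k\<in>UNIV. u $ k - l $ k)"
    using prod.reindex_bij_betw[OF bij, of "\<lambda>k. u $ k - l $ k"] by simp
  ultimately show "\<exists>l' u'. (\<lambda>x::real^'n. \<chi> k. x $ ?t k) -` box l u = box l' u' \<and>
      (\<forall>i. l' $ i \<le> u' $ i) \<and> (\<Prod>i\<in>UNIV. u' $ i - l' $ i) = (\<Prod>i\<in>UNIV. u $ i - l $ i)"
    using le by (intro exI[of _ ?l] exI[of _ ?u]) auto
qed

lemma finite_measure_unit_sphere: "finite_measure (sphere_measure (0 :: real^'n::finite) 1)"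
  and measure_unit_sphere: "measure (sphere_measure (0 :: real^'n::finite) 1) (sphere 0 1)
      = CARD('n) * measure lborel (ball (0 :: real^'n) 1)"
proof -
  have "{y \<in> ball (0::real^'n) 1 - {0}. 0 + (1 / norm (y - 0)) *\<^sub>R (y - 0) \<in> sphere 0 1} = ball 0 1 - {0}"
    by auto
  then have "emeasure (sphere_measure (0 :: real^'n) 1) (sphere 0 1)
      = ennreal CARD('n) * emeasure lborel (ball (0 :: real^'n) 1 - {0})"
    using emeasure_sphere_measure[of 1 "sphere 0 1" "0 :: real^'n"] by simp
  also have "emeasure lborel (ball (0 :: real^'n) 1 - {0}) = emeasure lborel (ball (0 :: real^'n) 1)"
    by (subst emeasure_Diff) auto
  also have "\<dots> = ennreal (measure lborel (ball (0 :: real^'n) 1))"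
    by (rule emeasure_eq_ennreal_measure) (use emeasure_bounded_finite[OF bounded_ball, of "0::real^'n" 1] in \<open>auto\<close>)
  finally have e: "emeasure (sphere_measure (0 :: real^'n) 1) (sphere 0 1)
      = ennreal (CARD('n) * measure lborel (ball (0 :: real^'n) 1))"
    by (simp add: ennreal_mult)
  then show "finite_measure (sphere_measure (0 :: real^'n) 1)"
    by (intro finite_measureI) simp
  show "measure (sphere_measure (0 :: real^'n) 1) (sphere 0 1) = CARD('n) * measure lborel (ball (0 :: real^'n) 1)"
    using e by (simp add: measure_def)
qed

lemma integrable_continuous_unit_sphere:
  fixes f :: "real^'n::finite \<Rightarrow> 'b::{banach, second_countable_topology}"
  assumes "continuous_on (sphere 0 1) f"
  shows "integrable (sphere_measure 0 1) f"
proof -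
  interpret finite_measure "sphere_measure (0 :: real^'n) 1" by (rule finite_measure_unit_sphere)
  have "compact (f ` sphere 0 1)" using assms by (intro compact_continuous_image) auto
  then obtain B where "\<forall>y\<in>f ` sphere 0 1. norm y \<le> B"
    using compact_imp_bounded bounded_iff by metis
  then show ?thesis
    using continuous_on_imp_measurable_sphere_measure[OF assms]
    by (intro integrable_const_bound[of _ B]) auto
qed

lemma integral_unit_sphere_isometry:
  fixes f :: "real^'n::finite \<Rightarrow> 'b::{banach, second_countable_topology}"
  assumes Q: "lebesgue_isometry Q" and f: "continuous_on (sphere 0 1) (\<lambda>\<xi>. f (Q \<xi>))"
  shows "(\<integral>\<xi>. f (Q \<xi>) \<partial>sphere_measure 0 1) = (\<integral>\<xi>. f \<xi> \<partial>sphere_measure 0 1)"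
  using integral_sphere_measure_similarity[OF Q, of 1 1 f 0 0]
    continuous_on_imp_measurable_sphere_measure[OF f] by simp

text \<open>The integrand is odd under the reflection of coordinate \<open>i\<close>.\<close>

lemma integral_unit_sphere_coordinate:
  "(\<integral>\<xi>. \<xi> $ i \<partial>sphere_measure (0 :: real^'n::finite) 1) = 0"
  using integral_unit_sphere_isometry[OF lebesgue_isometry_reflect_coordinate[of i], of "\<lambda>\<xi>. \<xi> $ i"]
  by (simp add: continuous_intros)

text \<open>Reflecting coordinate \<open>i\<close> kills the mixed moments. Swapping coordinates shows that the \<open>n\<close>
  pure second moments agree, and their sum is the integral of \<open>\<bar>\<xi>\<bar>\<^sup>2 = 1\<close>, that is, the area
  \<open>n \<omega>\<^sub>n\<close> of the sphere.\<close>

lemma integral_unit_sphere_coordinate_product: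
  "(\<integral>\<xi>. \<xi> $ i * \<xi> $ j \<partial>sphere_measure (0 :: real^'n::finite) 1)
    = (if i = j then measure lborel (ball (0 :: real^'n) 1) else 0)"
proof (cases "i = j")
  case False
  then show ?thesis
    using integral_unit_sphere_isometry[OF lebesgue_isometry_reflect_coordinate[of i], of "\<lambda>\<xi>. \<xi> $ i * \<xi> $ j"]
    by (simp add: continuous_intros)
next
  case True
  let ?\<sigma> = "sphere_measure (0 :: real^'n) 1"
  have eq: "(\<integral>\<xi>. \<xi> $ k * \<xi> $ k \<partial>?\<sigma>) = (\<integral>\<xi>. \<xi> $ i * \<xi> $ i \<partial>?\<sigma>)" for k
    using integral_unit_sphere_isometry[OF lebesgue_isometry_swap_coordinates[of i k], of "\<lambda>\<xi>. \<xi> $ i * \<xi> $ i"]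
    by (simp add: continuous_intros)
  have "CARD('n) * (\<integral>\<xi>. \<xi> $ i * \<xi> $ i \<partial>?\<sigma>) = (\<Sum>k\<in>UNIV. (\<integral>\<xi>. \<xi> $ k * \<xi> $ k \<partial>?\<sigma>))"
    by (subst sum.cong[OF refl eq]) simp
  also have "\<dots> = (\<integral>\<xi>. (\<Sum>k\<in>UNIV. \<xi> $ k * \<xi> $ k) \<partial>?\<sigma>)"
    by (intro Bochner_Integration.integral_sum[symmetric] integrable_continuous_unit_sphere continuous_intros)
  also have "\<dots> = (\<integral>\<xi>. 1 \<partial>?\<sigma>)"
    by (intro Bochner_Integration.integral_cong)
      (auto simp: norm_eq_1 inner_vec_def)
  also have "\<dots> = CARD('n) * measure lborel (ball (0 :: real^'n) 1)"
    by (simp add: measure_unit_sphere)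
  finally show ?thesis using True by simp
qed

section \<open>Weak convergence against uniformly convergent operator fields\<close>

text \<open>The Banach-Steinhaus theorem, by Baire category: the closed sets on which all \<open>T i\<close> are bounded
  by \<open>m\<close> cover the space as \<open>m\<close> varies, so one of them contains a ball \<open>cball x0 e\<close>, and differences of points of
  that ball reach every direction.\<close>

lemma uniform_boundedness:
  fixes T :: "'i \<Rightarrow> 'a::{real_normed_vector,complete_space} \<Rightarrow>\<^sub>L 'b::real_normed_vector"
  assumes bnd: "\<And>x. bounded (range (\<lambda>i. T i x))"
  shows "bounded (range T)"
proof -
  define C where "C m = (\<Inter>i. {x. norm (T i x) \<le> real m})" for m :: nat
  have closed_C: "closed (C m)" for m
    unfolding C_def by (intro closed_INT ballI closed_Collect_le continuous_intros)
  have cover: "\<exists>m. x \<in> C m" for x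
  proof -
    obtain B where B: "norm (T i x) \<le> B" for i
      using bnd[of x] by (auto simp: bounded_iff)
    obtain m :: nat where "B \<le> real m" using real_arch_simple by blast
    then have "x \<in> C m" using B order_trans by (fastforce simp: C_def)
    then show ?thesis ..
  qed
  have "\<exists>m. interior (C m) \<noteq> {}"
  proof (rule ccontr)
    assume "\<not> ?thesis"
    then have "Met_TC.mtopology interior_of \<Union>(range C) = {}"
      using closed_C by (intro Met_TC.metric_Baire_category_alt) (auto simp: complete_UNIV)
    moreover have "\<Union>(range C) = UNIV" using cover by auto
    ultimately show False by simp
  qed
  then obtain m x0 where "x0 \<in> interior (C m)" by blast
  then obtain e where e: "0 < e" "cball x0 e \<subseteq> C m"
    by (meson mem_interior_cball)
  have "norm (T i) \<le> 2 * real m / e" for i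
  proof (rule norm_blinfun_bound)
    show "0 \<le> 2 * real m / e" using e(1) by simp
    fix v
    show "norm (T i v) \<le> 2 * real m / e * norm v"
    proof (cases "v = 0")
      case False
      let ?w = "(e / norm v) *\<^sub>R v"
      have "norm ?w = e" using e(1) False by simp
      then have "x0 + ?w \<in> C m" "x0 \<in> C m"
        using e by (auto simp: subset_iff dist_norm)
      then have "norm (T i (x0 + ?w)) \<le> real m" "norm (T i x0) \<le> real m"
        by (auto simp: C_def)
      moreover have Tw: "T i ?w = T i (x0 + ?w) - T i x0" by (simp add: blinfun.add_right)
      ultimately have "norm (T i ?w) \<le> 2 * real m"
        unfolding Tw using norm_triangle_ineq4[of "T i (x0 + ?w)" "T i x0"] by linarith
      then have "e / norm v * norm (T i v) \<le> 2 * real m"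
        using e(1) by (simp add: blinfun.scaleR_right)
      then show ?thesis using False e(1) by (simp add: field_simps)
    qed (simp add: blinfun.zero_right)
  qed
  then show ?thesis by (auto simp: bounded_iff)
qed

text \<open>Pointwise convergence forces a common bound on the norms, so the error \<open>T k (X k - x)\<close> vanishes.\<close>

lemma pointwise_limit_apply_tendsto:
  fixes T :: "nat \<Rightarrow> 'a::{real_normed_vector,complete_space} \<Rightarrow>\<^sub>L 'b::real_normed_vector"
  assumes lim: "\<And>x. (\<lambda>k. T k x) \<longlonglongrightarrow> l x" and X: "X \<longlonglongrightarrow> x"
  shows "(\<lambda>k. T k (X k)) \<longlonglongrightarrow> l x"
proof -
  have "bounded (range T)"
    by (rule uniform_boundedness) (rule convergent_imp_bounded[OF lim])
  then obtain B where B: "norm (T k) \<le> B" for k by (auto simp: bounded_iff)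
  have "(\<lambda>k. T k (X k - x)) \<longlonglongrightarrow> 0"
  proof (rule Lim_null_comparison)
    show "\<forall>\<^sub>F k in sequentially. norm (T k (X k - x)) \<le> B * norm (X k - x)"
      using norm_blinfun B mult_right_mono[OF B norm_ge_zero] order_trans
      by (intro always_eventually allI) blast
    show "(\<lambda>k. B * norm (X k - x)) \<longlonglongrightarrow> 0"
      using tendsto_mult_right_zero[OF tendsto_norm_zero[OF LIM_zero[OF X]], of B] by simp
  qed
  from tendsto_add[OF this lim[of x]] show ?thesis
    by (simp add: blinfun.diff_right)
qed

lemma in_Lp_bounded:
  assumes M: "finite_measure M" and f: "f \<in> borel_measurable M" and b: "\<And>x. norm (f x) \<le> b" and q: "0 \<le> q"
  shows "in_Lp M q f"
proof -
  interpret finite_measure M by fact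
  have "integrable M (\<lambda>x. norm (f x) powr q)"
    using f b q by (intro integrable_const_bound[of _ "b powr q"]) (auto intro!: powr_mono2)
  then show ?thesis using f by (simp add: in_Lp_def)
qed

lemma in_Lp_imp_integrable:
  assumes M: "finite_measure M" and f: "in_Lp M p f" and p: "1 \<le> p"
  shows "integrable M f"
proof -
  interpret finite_measure M by fact
  show ?thesis
  proof (rule Bochner_Integration.integrable_bound)
    show "integrable M (\<lambda>x. 1 + norm (f x) powr p)"
      using f by (auto simp: in_Lp_def)
    show "AE x in M. norm (f x) \<le> norm (1 + norm (f x) powr p)"
    proof (rule AE_I2)
      fix x
      have "norm (f x) \<le> 1 + norm (f x) powr p"
      proof (cases "norm (f x) \<le> 1")
        case False
        then have "norm (f x) powr 1 \<le> norm (f x) powr p" using p by (intro powr_mono) auto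
        then show ?thesis using False by simp
      qed (simp add: add_increasing2)
      then show "norm (f x) \<le> norm (1 + norm (f x) powr p)" by simp
    qed
  qed (use f in \<open>auto simp: in_Lp_def\<close>)
qed

text \<open>Expanding in a basis of the finite-dimensional space \<open>'e\<close> avoids joint measurability
  of operator application.\<close>

lemma measurable_blinfun_apply:
  fixes K :: "'x::topological_space \<Rightarrow> 'e::euclidean_space \<Rightarrow>\<^sub>L 'f::euclidean_space"
  assumes id: "(\<lambda>\<xi>. \<xi>) \<in> M \<rightarrow>\<^sub>M borel" and K: "continuous_on UNIV K" and f: "f \<in> borel_measurable M"
  shows "(\<lambda>\<xi>. K \<xi> (f \<xi>)) \<in> borel_measurable M"
proof -
  have [measurable]: "(\<lambda>\<xi>. K \<xi> e) \<in> borel_measurable M" for e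
    by (rule measurable_compose[OF id borel_measurable_continuous_onI])
       (intro continuous_intros K)
  note f [measurable]
  have "(\<lambda>\<xi>. K \<xi> (f \<xi>)) = (\<lambda>\<xi>. \<Sum>e\<in>Basis. (f \<xi> \<bullet> e) *\<^sub>R K \<xi> e)"
    by (subst (1) euclidean_representation[symmetric])
       (simp add: blinfun.sum_right blinfun.scaleR_right del: euclidean_representation)
  then show ?thesis by simp
qed

lemma integrable_blinfun_apply:
  fixes K :: "'x::topological_space \<Rightarrow> 'e::euclidean_space \<Rightarrow>\<^sub>L 'f::euclidean_space"
  assumes id: "(\<lambda>\<xi>. \<xi>) \<in> M \<rightarrow>\<^sub>M borel" and K: "continuous_on UNIV K" "\<And>\<xi>. norm (K \<xi>) \<le> b"
    and f: "integrable M f"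
  shows "integrable M (\<lambda>\<xi>. K \<xi> (f \<xi>))"
proof (rule Bochner_Integration.integrable_bound)
  show "integrable M (\<lambda>\<xi>. b * norm (f \<xi>))" using f by simp
  show "AE \<xi> in M. norm (K \<xi> (f \<xi>)) \<le> norm (b * norm (f \<xi>))"
  proof (rule AE_I2)
    fix \<xi>
    have "norm (K \<xi> (f \<xi>)) \<le> norm (K \<xi>) * norm (f \<xi>)" by (rule norm_blinfun)
    also have "\<dots> \<le> b * norm (f \<xi>)" using K(2) by (intro mult_right_mono) auto
    finally show "norm (K \<xi> (f \<xi>)) \<le> norm (b * norm (f \<xi>))" by simp
  qed
qed (use f in \<open>auto intro!: measurable_blinfun_apply id K\<close>)

text \<open>Testing with a fixed continuous operator field: the component of \<open>K \<xi> (f i \<xi>)\<close> along \<open>e\<close> is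
  the pairing of \<open>f i\<close> with the adjoint of \<open>K \<xi>\<close> applied to \<open>e\<close>, which is bounded and therefore
  lies in the dual space.\<close>

lemma weakly_tendsto_Lp_apply_operator:
  fixes K :: "'x::topological_space \<Rightarrow> 'e::euclidean_space \<Rightarrow>\<^sub>L 'f::euclidean_space"
  assumes M: "finite_measure M" and id: "(\<lambda>\<xi>. \<xi>) \<in> M \<rightarrow>\<^sub>M borel" and p: "1 < p"
    and weak: "weakly_tendsto_Lp M p f g F"
    and K: "continuous_on UNIV K" "\<And>\<xi>. norm (K \<xi>) \<le> b"
  shows "((\<lambda>i. \<integral>\<xi>. K \<xi> (f i \<xi>) \<partial>M) \<longlongrightarrow> (\<integral>\<xi>. K \<xi> (g \<xi>) \<partial>M)) F"
  unfolding tendsto_componentwise_iff[of "\<lambda>i. \<integral>\<xi>. K \<xi> (f i \<xi>) \<partial>M"]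
proof
  fix e :: 'f assume e: "e \<in> Basis"
  \<comment> \<open>the adjoint of \<open>K \<xi>\<close>, applied to \<open>e\<close>\<close>
  define \<phi> where "\<phi> \<xi> = (\<Sum>d\<in>Basis. (K \<xi> d \<bullet> e) *\<^sub>R d)" for \<xi>
  have adj: "K \<xi> v \<bullet> e = v \<bullet> \<phi> \<xi>" for \<xi> v
    by (subst (1) euclidean_representation[symmetric, of v])
       (simp add: \<phi>_def blinfun.sum_right blinfun.scaleR_right inner_sum_left inner_sum_right ac_simps del: euclidean_representation)
  have comp: "(\<integral>\<xi>. K \<xi> (h \<xi>) \<partial>M) \<bullet> e = (\<integral>\<xi>. h \<xi> \<bullet> \<phi> \<xi> \<partial>M)" if "in_Lp M p h" for h
    using integrable_blinfun_apply[OF id K in_Lp_imp_integrable[OF M that]] p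
    by (simp add: integral_inner_left[symmetric] adj)
  have "continuous_on UNIV \<phi>" unfolding \<phi>_def by (intro continuous_intros K)
  then have "\<phi> \<in> borel_measurable M"
    by (intro measurable_compose[OF id] borel_measurable_continuous_onI)
  moreover have "norm (\<phi> \<xi>) \<le> b" for \<xi>
  proof -
    have "norm (\<phi> \<xi>) * norm (\<phi> \<xi>) = K \<xi> (\<phi> \<xi>) \<bullet> e"
      by (simp add: adj power2_norm_eq_inner[symmetric] power2_eq_square)
    also have "\<dots> \<le> norm (K \<xi> (\<phi> \<xi>)) * norm e" by (rule norm_cauchy_schwarz)
    also have "\<dots> \<le> norm (K \<xi>) * norm (\<phi> \<xi>)" using e by (simp add: norm_blinfun)
    also have "\<dots> \<le> b * norm (\<phi> \<xi>)" using K(2) by (intro mult_right_mono) auto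
    finally show ?thesis
      using order_trans[OF norm_ge_zero K(2)] by (cases "norm (\<phi> \<xi>) = 0") auto
  qed
  ultimately have \<phi>: "in_Lp M (p / (p - 1)) \<phi>" using p by (intro in_Lp_bounded[OF M]) auto
  have "1 / p + 1 / (p / (p - 1)) = 1" using p by (simp add: field_simps)
  then have "((\<lambda>i. \<integral>\<xi>. f i \<xi> \<bullet> \<phi> \<xi> \<partial>M) \<longlongrightarrow> (\<integral>\<xi>. g \<xi> \<bullet> \<phi> \<xi> \<partial>M)) F"
    using weak \<phi> unfolding weakly_tendsto_Lp_def by blast
  moreover have "\<forall>\<^sub>F i in F. (\<integral>\<xi>. f i \<xi> \<bullet> \<phi> \<xi> \<partial>M) = (\<integral>\<xi>. K \<xi> (f i \<xi>) \<partial>M) \<bullet> e"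
    using weak unfolding weakly_tendsto_Lp_def
    by (auto elim!: eventually_mono simp: comp)
  moreover have "(\<integral>\<xi>. g \<xi> \<bullet> \<phi> \<xi> \<partial>M) = (\<integral>\<xi>. K \<xi> (g \<xi>) \<partial>M) \<bullet> e"
    using weak unfolding weakly_tendsto_Lp_def by (auto simp: comp)
  ultimately show "((\<lambda>i. (\<integral>\<xi>. K \<xi> (f i \<xi>) \<partial>M) \<bullet> e) \<longlongrightarrow> (\<integral>\<xi>. K \<xi> (g \<xi>) \<partial>M) \<bullet> e) F"
    by (simp add: tendsto_cong)
qed

text \<open>Each \<open>f k\<close> is viewed as the operator \<open>\<Phi> \<mapsto> \<integral> \<Phi> (f k)\<close> on the Banach space of bounded continuous
  operator fields. On this space the integrals converge pointwise, so \<open>pointwise_limit_apply_tendsto\<close>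
  applies.\<close>

lemma weakly_tendsto_Lp_apply_uniform_limit:
  fixes K :: "nat \<Rightarrow> 'x::metric_space \<Rightarrow> 'e::euclidean_space \<Rightarrow>\<^sub>L 'f::euclidean_space"
  assumes M: "finite_measure M" and id: "(\<lambda>\<xi>. \<xi>) \<in> M \<rightarrow>\<^sub>M borel" and p: "1 < p"
    and weak: "weakly_tendsto_Lp M p f g sequentially" and f: "\<And>k. in_Lp M p (f k)"
    and K: "\<And>k. K k \<in> bcontfun" and unif: "uniform_limit UNIV K K' sequentially"
  shows "(\<lambda>k. \<integral>\<xi>. K k \<xi> (f k \<xi>) \<partial>M) \<longlonglongrightarrow> (\<integral>\<xi>. K' \<xi> (g \<xi>) \<partial>M)"
proof -
  note int = integrable_blinfun_apply[OF id _ _ in_Lp_imp_integrable[OF M f less_imp_le[OF p]]]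
  have ib: "integrable M (\<lambda>\<xi>. (\<Phi> :: 'x \<Rightarrow>\<^sub>C ('e \<Rightarrow>\<^sub>L 'f)) \<xi> (f k \<xi>))" for \<Phi> k
    by (rule int[of _ "norm \<Phi>"]) (auto intro: norm_bounded)
  have bl: "bounded_linear (\<lambda>\<Phi>::'x \<Rightarrow>\<^sub>C ('e \<Rightarrow>\<^sub>L 'f). \<integral>\<xi>. \<Phi> \<xi> (f k \<xi>) \<partial>M)" for k
  proof (rule bounded_linear_intro[where K = "\<integral>\<xi>. norm (f k \<xi>) \<partial>M"])
    fix \<Phi> \<Psi> :: "'x \<Rightarrow>\<^sub>C ('e \<Rightarrow>\<^sub>L 'f)" and a :: real
    show "(\<integral>\<xi>. (\<Phi> + \<Psi>) \<xi> (f k \<xi>) \<partial>M) = (\<integral>\<xi>. \<Phi> \<xi> (f k \<xi>) \<partial>M) + (\<integral>\<xi>. \<Psi> \<xi> (f k \<xi>) \<partial>M)"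
      using ib by (simp add: plus_bcontfun.rep_eq blinfun.add_left)
    show "(\<integral>\<xi>. (a *\<^sub>R \<Phi>) \<xi> (f k \<xi>) \<partial>M) = a *\<^sub>R (\<integral>\<xi>. \<Phi> \<xi> (f k \<xi>) \<partial>M)"
      by (simp add: scaleR_bcontfun.rep_eq blinfun.scaleR_left)
    have "norm (\<integral>\<xi>. \<Phi> \<xi> (f k \<xi>) \<partial>M) \<le> (\<integral>\<xi>. norm \<Phi> * norm (f k \<xi>) \<partial>M)"
    proof (rule order_trans[OF integral_norm_bound integral_mono])
      show "integrable M (\<lambda>\<xi>. norm \<Phi> * norm (f k \<xi>))"
        using in_Lp_imp_integrable[OF M f[of k]] p by simp
      show "norm (\<Phi> \<xi> (f k \<xi>)) \<le> norm \<Phi> * norm (f k \<xi>)" for \<xi>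
        by (rule order_trans[OF norm_blinfun mult_right_mono[OF norm_bounded]]) simp
    qed (rule integrable_norm[OF ib])
    then show "norm (\<integral>\<xi>. \<Phi> \<xi> (f k \<xi>) \<partial>M) \<le> norm \<Phi> * (\<integral>\<xi>. norm (f k \<xi>) \<partial>M)" by simp
  qed
  define T where "T k = Blinfun (\<lambda>\<Phi>::'x \<Rightarrow>\<^sub>C ('e \<Rightarrow>\<^sub>L 'f). \<integral>\<xi>. \<Phi> \<xi> (f k \<xi>) \<partial>M)" for k
  have T: "T k \<Phi> = (\<integral>\<xi>. \<Phi> \<xi> (f k \<xi>) \<partial>M)" for k \<Phi>
    unfolding T_def by (rule bounded_linear_Blinfun_apply[OF bl, THEN fun_cong])
  have K': "K' \<in> bcontfun"
  proof -
    have "continuous_on UNIV K'"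
      by (rule uniform_limit_theorem[OF _ unif]) (use K in \<open>auto simp: bcontfun_def\<close>)
    moreover have "bounded (range K')"
      by (rule uniform_limit_bounded[OF unif]) (use K in \<open>auto simp: bcontfun_def\<close>)
    ultimately show ?thesis by (simp add: bcontfun_def)
  qed
  have "(\<lambda>k. Bcontfun (K k)) \<longlonglongrightarrow> Bcontfun K'"
    by (rule uniform_limit_tendsto_bcontfun) (use unif K K' in \<open>simp add: Bcontfun_inverse\<close>)
  moreover have "(\<lambda>k. T k \<Phi>) \<longlonglongrightarrow> (\<integral>\<xi>. \<Phi> \<xi> (g \<xi>) \<partial>M)" for \<Phi>
    unfolding T by (rule weakly_tendsto_Lp_apply_operator[OF M id p weak]) (auto intro: norm_bounded)
  ultimately have "(\<lambda>k. T k (Bcontfun (K k))) \<longlonglongrightarrow> (\<integral>\<xi>. Bcontfun K' \<xi> (g \<xi>) \<partial>M)"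
    by (rule pointwise_limit_apply_tendsto[rotated, where l = "\<lambda>\<Phi>::'x \<Rightarrow>\<^sub>C ('e \<Rightarrow>\<^sub>L 'f). \<integral>\<xi>. \<Phi> \<xi> (g \<xi>) \<partial>M"])
  then show ?thesis using K K' by (simp add: T Bcontfun_inverse)
qed

section \<open>Flux of a differentiable field through small spheres\<close>

text \<open>Insert the first-order expansion of \<open>a\<close> at \<open>x\<close>, which is uniform over the unit sphere. The
  constant term drops out by the vanishing first moments, although it is divided by \<open>\<epsilon>\<close>; the
  linear term \<open>\<Sum>i. \<xi>\<^sub>i a' (axis i 1)\<close> meets the second moments of \<open>\<sigma>\<close> and leaves only \<open>i = j\<close>.\<close>

lemma unit_sphere_flux_tendsto_partial_derivative:
  fixes a :: "real^'n::finite \<Rightarrow> 'b::euclidean_space"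
  assumes d: "(a has_derivative a') (at x)" and b: "0 < b" and cont: "continuous_on (ball x b) a"
  shows "((\<lambda>\<epsilon>. (1 / \<epsilon>) *\<^sub>R (\<integral>\<xi>. (\<xi> $ j) *\<^sub>R a (x + \<epsilon> *\<^sub>R \<xi>) \<partial>sphere_measure 0 1))
    \<longlongrightarrow> measure lborel (ball (0 :: real^'n) 1) *\<^sub>R a' (axis j 1)) (at_right 0)"
proof (rule tendstoI)
  let ?\<sigma> = "sphere_measure (0 :: real^'n) 1"
  let ?\<omega> = "measure lborel (ball (0 :: real^'n) 1)"
  fix e :: real assume e: "0 < e"
  interpret finite_measure ?\<sigma> by (rule finite_measure_unit_sphere)
  define C where "C = measure ?\<sigma> (sphere 0 1)"
  define \<eta> where "\<eta> = e / (C + 1)"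
  have C: "0 \<le> C" by (simp add: C_def)
  then have \<eta>: "0 < \<eta>" "\<eta> * C < e" using e by (auto simp: \<eta>_def field_simps)
  have bl: "bounded_linear a'" using d by (rule has_derivative_bounded_linear)
  then interpret a': bounded_linear a' .
  have cont': "continuous_on T a'" for T by (rule linear_continuous_on[OF bl])
  obtain \<delta> where \<delta>: "0 < \<delta>" "\<And>y. norm (y - x) < \<delta> \<Longrightarrow> norm (a y - a x - a' (y - x)) \<le> \<eta> * norm (y - x)"
    using d \<eta>(1) unfolding has_derivative_at_alt by blast
  have quad: "(\<integral>\<xi>. (\<xi> $ j) *\<^sub>R a' \<xi> \<partial>?\<sigma>) = ?\<omega> *\<^sub>R a' (axis j 1)"
  proof -
    have exp: "a' \<xi> = (\<Sum>i\<in>UNIV. (\<xi> $ i) *\<^sub>R a' (axis i 1))" for \<xi>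
    proof -
      have "\<xi> = (\<Sum>i\<in>UNIV. (\<xi> $ i) *\<^sub>R axis i 1)"
        using basis_expansion[of \<xi>] by (simp add: scalar_mult_eq_scaleR)
      then have "a' \<xi> = a' (\<Sum>i\<in>UNIV. (\<xi> $ i) *\<^sub>R axis i 1)" by simp
      then show ?thesis by (simp only: a'.sum a'.scaleR)
    qed
    have "(\<integral>\<xi>. (\<xi> $ j) *\<^sub>R a' \<xi> \<partial>?\<sigma>) = (\<integral>\<xi>. (\<Sum>i\<in>UNIV. (\<xi> $ j * \<xi> $ i) *\<^sub>R a' (axis i 1)) \<partial>?\<sigma>)"
      by (subst exp) (simp add: scaleR_sum_right)
    also have "\<dots> = (\<Sum>i\<in>UNIV. (\<integral>\<xi>. (\<xi> $ j * \<xi> $ i) *\<^sub>R a' (axis i 1) \<partial>?\<sigma>))"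
      by (intro Bochner_Integration.integral_sum integrable_continuous_unit_sphere continuous_intros)
    also have "\<dots> = (\<Sum>i\<in>UNIV. (\<integral>\<xi>. \<xi> $ j * \<xi> $ i \<partial>?\<sigma>) *\<^sub>R a' (axis i 1))"
      by (intro sum.cong refl integral_scaleR_left integrable_continuous_unit_sphere continuous_intros)
    also have "\<dots> = (\<Sum>i\<in>UNIV. if i = j then ?\<omega> *\<^sub>R a' (axis i 1) else 0)"
      by (intro sum.cong refl) (simp add: integral_unit_sphere_coordinate_product)
    finally show ?thesis by simp
  qed
  have "eventually (\<lambda>\<epsilon>. \<epsilon> < min \<delta> b) (at_right 0)"
    using \<delta>(1) b by (intro order_tendstoD[OF tendsto_ident_at]) auto
  moreover have "eventually (\<lambda>\<epsilon>::real. 0 < \<epsilon>) (at_right 0)"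
    by (simp add: eventually_at_right_less)
  ultimately show "\<forall>\<^sub>F \<epsilon> in at_right 0.
      dist ((1 / \<epsilon>) *\<^sub>R (\<integral>\<xi>. (\<xi> $ j) *\<^sub>R a (x + \<epsilon> *\<^sub>R \<xi>) \<partial>?\<sigma>)) (?\<omega> *\<^sub>R a' (axis j 1)) < e"
  proof eventually_elim
    case (elim \<epsilon>)
    \<comment> \<open>the remainder of the expansion, weighted as in the difference quotient\<close>
    define g where "g \<xi> = (\<xi> $ j / \<epsilon>) *\<^sub>R (a (x + \<epsilon> *\<^sub>R \<xi>) - a x - a' (\<epsilon> *\<^sub>R \<xi>))" for \<xi>
    have ca: "continuous_on (sphere 0 1) (\<lambda>\<xi>. a (x + \<epsilon> *\<^sub>R \<xi>))"
      by (rule continuous_on_compose2[OF cont]) (use elim in \<open>auto intro!: continuous_intros simp: dist_norm\<close>)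
    have int_a: "integrable ?\<sigma> (\<lambda>\<xi>. (\<xi> $ j) *\<^sub>R a (x + \<epsilon> *\<^sub>R \<xi>))"
      by (intro integrable_continuous_unit_sphere continuous_intros ca)
    have int_x: "integrable ?\<sigma> (\<lambda>\<xi>. (\<xi> $ j) *\<^sub>R a x)"
      by (intro integrable_continuous_unit_sphere continuous_intros)
    have int_a': "integrable ?\<sigma> (\<lambda>\<xi>. (\<xi> $ j) *\<^sub>R a' \<xi>)"
      by (intro integrable_continuous_unit_sphere continuous_intros cont')
    have int_g: "integrable ?\<sigma> g"
      unfolding g_def
      by (intro integrable_continuous_unit_sphere continuous_intros ca a'.continuous_on) (use elim in simp)
    have g_eq: "g = (\<lambda>\<xi>. (1 / \<epsilon>) *\<^sub>R ((\<xi> $ j) *\<^sub>R a (x + \<epsilon> *\<^sub>R \<xi>)) - (1 / \<epsilon>) *\<^sub>R ((\<xi> $ j) *\<^sub>R a x) - (\<xi> $ j) *\<^sub>R a' \<xi>)"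
      using elim by (simp add: g_def fun_eq_iff a'.scaleR scaleR_diff_right)
    have "(\<integral>\<xi>. (\<xi> $ j) *\<^sub>R a x \<partial>?\<sigma>) = (\<integral>\<xi>. \<xi> $ j \<partial>?\<sigma>) *\<^sub>R a x"
      by (intro integral_scaleR_left integrable_continuous_unit_sphere continuous_intros)
    then have zero: "(\<integral>\<xi>. (\<xi> $ j) *\<^sub>R a x \<partial>?\<sigma>) = 0" by (simp add: integral_unit_sphere_coordinate)
    have "(\<integral>\<xi>. g \<xi> \<partial>?\<sigma>) =
        (1 / \<epsilon>) *\<^sub>R (\<integral>\<xi>. (\<xi> $ j) *\<^sub>R a (x + \<epsilon> *\<^sub>R \<xi>) \<partial>?\<sigma>) - (1 / \<epsilon>) *\<^sub>R (\<integral>\<xi>. (\<xi> $ j) *\<^sub>R a x \<partial>?\<sigma>)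
          - (\<integral>\<xi>. (\<xi> $ j) *\<^sub>R a' \<xi> \<partial>?\<sigma>)"
      unfolding g_eq using int_a int_x int_a' 
      by (simp del: scaleR_scaleR)
    then have "dist ((1 / \<epsilon>) *\<^sub>R (\<integral>\<xi>. (\<xi> $ j) *\<^sub>R a (x + \<epsilon> *\<^sub>R \<xi>) \<partial>?\<sigma>)) (?\<omega> *\<^sub>R a' (axis j 1)) = norm (\<integral>\<xi>. g \<xi> \<partial>?\<sigma>)"
      by (simp add: zero quad dist_norm)
    also have "\<dots> \<le> (\<integral>\<xi>. norm (g \<xi>) \<partial>?\<sigma>)" by (rule integral_norm_bound)
    also have "\<dots> \<le> (\<integral>\<xi>. \<eta> \<partial>?\<sigma>)"
    proof (rule integral_mono)
      show "norm (g \<xi>) \<le> \<eta>" if "\<xi> \<in> space ?\<sigma>" for \<xi>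
      proof -
        have n: "norm \<xi> = 1" using that by simp
        have "norm (a (x + \<epsilon> *\<^sub>R \<xi>) - a x - a' (\<epsilon> *\<^sub>R \<xi>)) \<le> \<eta> * \<epsilon>"
          using \<delta>(2)[of "x + \<epsilon> *\<^sub>R \<xi>"] elim n by simp
        moreover have "\<bar>\<xi> $ j\<bar> \<le> 1" using component_le_norm_cart[of \<xi> j] n by simp
        ultimately have "\<bar>\<xi> $ j\<bar> * norm (a (x + \<epsilon> *\<^sub>R \<xi>) - a x - a' (\<epsilon> *\<^sub>R \<xi>)) \<le> 1 * (\<eta> * \<epsilon>)"
          by (intro mult_mono) auto
        moreover have "norm (g \<xi>) = \<bar>\<xi> $ j\<bar> * norm (a (x + \<epsilon> *\<^sub>R \<xi>) - a x - a' (\<epsilon> *\<^sub>R \<xi>)) / \<epsilon>"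
          using elim by (simp add: g_def del: scaleR_right_diff_distrib)
        ultimately show ?thesis using elim by (simp add: pos_divide_le_eq)
      qed
    qed (use int_g in auto)
    also have "\<dots> = \<eta> * C" by (simp add: C_def)
    also have "\<dots> < e" by (rule \<eta>(2))
    finally show ?case .
  qed
qed

section \<open>Weak convergence against the symbol\<close>

text \<open>The coefficients are continuous only near \<open>x\<close>, whereas test fields must be continuous on the
  whole space. Composing with a retraction onto the closed unit ball extends the fields
  without changing them on the unit sphere.\<close>

definition ball_retraction :: "'a::real_normed_vector \<Rightarrow> 'a" where
  "ball_retraction \<xi> = (1 / max 1 (norm \<xi>)) *\<^sub>R \<xi>"

lemma continuous_on_ball_retraction: "continuous_on S ball_retraction"
  unfolding ball_retraction_def by (intro continuous_intros) auto

lemma norm_ball_retraction: "norm (ball_retraction \<xi>) \<le> 1"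
  by (auto simp: ball_retraction_def max_def)

lemma ball_retraction_sphere: "norm \<xi> = 1 \<Longrightarrow> ball_retraction \<xi> = \<xi>"
  by (simp add: ball_retraction_def)

lemma continuous_on_symbol:
  fixes A :: "'n::finite \<Rightarrow> real^'n \<Rightarrow> 'e::euclidean_space \<Rightarrow>\<^sub>L 'f::euclidean_space"
  assumes A: "\<And>j. continuous_on (ball x b) (A j)" and \<epsilon>: "0 \<le> \<epsilon>" "\<epsilon> < b"
  shows "continuous_on (cball 0 1) (\<lambda>\<xi>. symbol A (x + \<epsilon> *\<^sub>R \<xi>) \<xi>)"
proof -
  have "continuous_on (cball 0 1) (\<lambda>\<xi>. A j (x + \<epsilon> *\<^sub>R \<xi>))" for j
  proof (rule continuous_on_compose2[OF A])
    show "(\<lambda>\<xi>. x + \<epsilon> *\<^sub>R \<xi>) ` cball 0 1 \<subseteq> ball x b"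
    proof
      fix y assume "y \<in> (\<lambda>\<xi>. x + \<epsilon> *\<^sub>R \<xi>) ` cball 0 1"
      then obtain \<xi> where "norm \<xi> \<le> 1" "y = x + \<epsilon> *\<^sub>R \<xi>" by auto
      then show "y \<in> ball x b"
        using \<epsilon> mult_left_mono[of "norm \<xi>" 1 \<epsilon>] by (simp add: dist_norm)
    qed
  qed (intro continuous_intros)
  then show ?thesis
    unfolding symbol_def by (intro continuous_intros)
qed

lemma symbol_retraction_bcontfun:
  fixes A :: "'n::finite \<Rightarrow> real^'n \<Rightarrow> 'e::euclidean_space \<Rightarrow>\<^sub>L 'f::euclidean_space"
  assumes A: "\<And>j. continuous_on (ball x b) (A j)" and \<epsilon>: "0 \<le> \<epsilon>" "\<epsilon> < b"
  shows "(\<lambda>\<xi>. symbol A (x + \<epsilon> *\<^sub>R ball_retraction \<xi>) (ball_retraction \<xi>)) \<in> bcontfun"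
proof -
  let ?G = "\<lambda>\<xi>. symbol A (x + \<epsilon> *\<^sub>R \<xi>) \<xi>"
  have G: "continuous_on (cball 0 1) ?G" by (rule continuous_on_symbol[OF A \<epsilon>])
  have "continuous_on UNIV (\<lambda>\<xi>. ?G (ball_retraction \<xi>))"
    by (rule continuous_on_compose2[OF G continuous_on_ball_retraction]) (auto simp: norm_ball_retraction)
  moreover have "bounded (range (\<lambda>\<xi>. ?G (ball_retraction \<xi>)))"
  proof (rule bounded_subset)
    show "bounded (?G ` cball 0 1)"
      by (intro compact_imp_bounded compact_continuous_image G) auto
  qed (auto simp: norm_ball_retraction)
  ultimately show ?thesis by (simp add: bcontfun_def)
qed

lemma symbol_retraction_uniform_limit:
  fixes A :: "'n::finite \<Rightarrow> real^'n \<Rightarrow> 'e::euclidean_space \<Rightarrow>\<^sub>L 'f::euclidean_space"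
  assumes A: "\<And>j. isCont (A j) x" and \<epsilon>: "\<epsilon> \<longlonglongrightarrow> 0"
  shows "uniform_limit UNIV (\<lambda>k \<xi>. symbol A (x + \<epsilon> k *\<^sub>R ball_retraction \<xi>) (ball_retraction \<xi>))
    (\<lambda>\<xi>. symbol A x (ball_retraction \<xi>)) sequentially"
proof (rule uniform_limitI)
  fix e :: real assume e: "0 < e"
  let ?e = "e / CARD('n)"
  have "\<forall>\<^sub>F k in sequentially. \<forall>\<xi>. norm (A j (x + \<epsilon> k *\<^sub>R ball_retraction \<xi>) - A j x) < ?e" for j
  proof -
    have "0 < ?e" using e by simp
    then obtain \<delta> where \<delta>: "0 < \<delta>" "\<And>y. norm (y - x) < \<delta> \<Longrightarrow> norm (A j y - A j x) < ?e"
      using A[of j] unfolding continuous_at_eps_delta dist_norm by metis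
    have "\<forall>\<^sub>F k in sequentially. \<bar>\<epsilon> k\<bar> < \<delta>"
      using order_tendstoD(2)[OF tendsto_rabs[OF \<epsilon>], of \<delta>] \<delta>(1) by simp
    then show ?thesis
    proof eventually_elim
      case (elim k)
      have "norm (\<epsilon> k *\<^sub>R ball_retraction \<xi>) < \<delta>" for \<xi> :: "real^'n"
        using elim mult_left_mono[OF norm_ball_retraction[of \<xi>], of "\<bar>\<epsilon> k\<bar>"] by simp
      then show ?case using \<delta>(2) by simp
    qed
  qed
  then have "\<forall>\<^sub>F k in sequentially. \<forall>j \<xi>. norm (A j (x + \<epsilon> k *\<^sub>R ball_retraction \<xi>) - A j x) < ?e"
    by (simp add: eventually_all_finite)
  then show "\<forall>\<^sub>F k in sequentially. \<forall>\<xi>\<in>UNIV.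
      dist (symbol A (x + \<epsilon> k *\<^sub>R ball_retraction \<xi>) (ball_retraction \<xi>)) (symbol A x (ball_retraction \<xi>)) < e"
  proof eventually_elim
    case (elim k)
    show ?case
    proof
      fix \<xi> :: "real^'n"
      let ?\<rho> = "ball_retraction \<xi>"
      have "norm (symbol A (x + \<epsilon> k *\<^sub>R ?\<rho>) ?\<rho> - symbol A x ?\<rho>)
          = norm (\<Sum>j\<in>UNIV. (?\<rho> $ j) *\<^sub>R (A j (x + \<epsilon> k *\<^sub>R ?\<rho>) - A j x))"
        by (simp add: symbol_def sum_subtractf scaleR_diff_right)
      also have "\<dots> \<le> (\<Sum>j\<in>UNIV. norm ((?\<rho> $ j) *\<^sub>R (A j (x + \<epsilon> k *\<^sub>R ?\<rho>) - A j x)))"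
        by (rule norm_sum)
      also have "\<dots> < (\<Sum>j\<in>(UNIV :: 'n set). ?e)"
      proof (rule sum_strict_mono)
        fix j
        have "\<bar>?\<rho> $ j\<bar> \<le> 1"
          using component_le_norm_cart[of ?\<rho> j] norm_ball_retraction[of \<xi>] by linarith
        then have "\<bar>?\<rho> $ j\<bar> * norm (A j (x + \<epsilon> k *\<^sub>R ?\<rho>) - A j x) \<le> 1 * norm (A j (x + \<epsilon> k *\<^sub>R ?\<rho>) - A j x)"
          by (intro mult_right_mono) auto
        then show "norm ((?\<rho> $ j) *\<^sub>R (A j (x + \<epsilon> k *\<^sub>R ?\<rho>) - A j x)) < ?e"
          using elim by (simp add: le_less_trans)
      qed auto
      also have "\<dots> = e" by simp
      finally show "dist (symbol A (x + \<epsilon> k *\<^sub>R ?\<rho>) ?\<rho>) (symbol A x ?\<rho>) < e" by (simp add: dist_norm)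
    qed
  qed
qed

text \<open>As \<open>\<epsilon>\<close> tends to \<open>0\<close> the symbol at \<open>x + \<epsilon> \<xi>\<close> converges uniformly to the symbol at \<open>x\<close>, so weak
  convergence survives the varying coefficients. It suffices to argue along sequences, which is
  where the uniform boundedness principle is available: a convergent sequence is bounded, a
  function with a limit at \<open>0\<close> only near \<open>0\<close>, and there on a neighbourhood that may vary with the
  test field.\<close>

lemma symbol_integral_weak_tendsto:
  fixes A :: "'n::finite \<Rightarrow> real^'n \<Rightarrow> 'e::euclidean_space \<Rightarrow>\<^sub>L 'f::euclidean_space"
  assumes b: "0 < b" and A: "\<And>j. continuous_on (ball x b) (A j)" and p: "1 < p"
    and weak: "weakly_tendsto_Lp (sphere_measure 0 1) p f g (at_right 0)"
  shows "((\<lambda>\<epsilon>. \<integral>\<xi>. symbol A (x + \<epsilon> *\<^sub>R \<xi>) \<xi> (f \<epsilon> \<xi>) \<partial>sphere_measure 0 1)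
    \<longlongrightarrow> (\<integral>\<xi>. symbol A x \<xi> (g \<xi>) \<partial>sphere_measure 0 1)) (at_right 0)"
proof -
  let ?\<sigma> = "sphere_measure (0 :: real^'n) 1"
  obtain c where c: "0 < c" "\<And>\<epsilon>. 0 < \<epsilon> \<Longrightarrow> \<epsilon> < c \<Longrightarrow> in_Lp ?\<sigma> p (f \<epsilon>)"
    using weak unfolding weakly_tendsto_Lp_def eventually_at_right_field by blast
  have isc: "isCont (A j) x" for j
    using A[of j] b by (auto simp: continuous_on_eq_continuous_at)
  have "0 < min b c" using b c by simp
  then show ?thesis
  proof (rule tendsto_at_right_sequentially)
    fix S :: "nat \<Rightarrow> real"
    assume S: "\<And>n. 0 < S n" "\<And>n. S n < min b c" "S \<longlonglongrightarrow> 0"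
    have F: "filterlim S (at_right 0) sequentially"
      using S by (auto simp: filterlim_at less_imp_neq[symmetric] intro!: always_eventually)
    let ?K = "\<lambda>k \<xi>. symbol A (x + S k *\<^sub>R ball_retraction \<xi>) (ball_retraction \<xi>)"
    have "(\<lambda>k. \<integral>\<xi>. ?K k \<xi> (f (S k) \<xi>) \<partial>?\<sigma>) \<longlonglongrightarrow> (\<integral>\<xi>. symbol A x (ball_retraction \<xi>) (g \<xi>) \<partial>?\<sigma>)"
    proof (rule weakly_tendsto_Lp_apply_uniform_limit[OF finite_measure_unit_sphere ident_measurable_sphere_measure p])
      show "in_Lp ?\<sigma> p (f (S k))" for k using c(2) S by simp
      then show "weakly_tendsto_Lp ?\<sigma> p (\<lambda>k. f (S k)) g sequentially"
        using weak unfolding weakly_tendsto_Lp_def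
        by (auto intro: filterlim_compose[OF _ F])
      show "?K k \<in> bcontfun" for k
        using S(1)[of k] S(2)[of k] by (intro symbol_retraction_bcontfun[OF A]) auto
      show "uniform_limit UNIV ?K (\<lambda>\<xi>. symbol A x (ball_retraction \<xi>)) sequentially"
        by (rule symbol_retraction_uniform_limit[OF isc S(3)])
    qed
    moreover have "(\<integral>\<xi>. ?K k \<xi> (f (S k) \<xi>) \<partial>?\<sigma>) = (\<integral>\<xi>. symbol A (x + S k *\<^sub>R \<xi>) \<xi> (f (S k) \<xi>) \<partial>?\<sigma>)" for k
      by (intro Bochner_Integration.integral_cong) (auto simp: ball_retraction_sphere)
    moreover have "(\<integral>\<xi>. symbol A x (ball_retraction \<xi>) (g \<xi>) \<partial>?\<sigma>) = (\<integral>\<xi>. symbol A x \<xi> (g \<xi>) \<partial>?\<sigma>)"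
      by (intro Bochner_Integration.integral_cong) (auto simp: ball_retraction_sphere)
    ultimately show "(\<lambda>k. \<integral>\<xi>. symbol A (x + S k *\<^sub>R \<xi>) \<xi> (f (S k) \<xi>) \<partial>?\<sigma>)
        \<longlonglongrightarrow> (\<integral>\<xi>. symbol A x \<xi> (g \<xi>) \<partial>?\<sigma>)"
      by simp
  qed
qed

section \<open>The limit of the averaged flux\<close>

lemma smooth_on_imp_continuous_on: "smooth_on S f \<Longrightarrow> continuous_on S f"
  using Ck_on.simps(1) unfolding smooth_on_def by blast

lemma smooth_on_imp_differentiable: "smooth_on S f \<Longrightarrow> x \<in> S \<Longrightarrow> f differentiable (at x)"
  using Ck_on.simps(2) unfolding smooth_on_def by blast

text \<open>The infinitesimal divergence theorem for the constant \<open>v\<close>, component by component of the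
  symbol.\<close>

lemma symbol_flux_tendsto_div_symbol:
  fixes A :: "'n::finite \<Rightarrow> real^'n \<Rightarrow> 'e::euclidean_space \<Rightarrow>\<^sub>L 'f::euclidean_space"
  assumes b: "0 < b" and A: "\<And>j. continuous_on (ball x b) (A j)" and d: "\<And>j. A j differentiable (at x)"
  shows "((\<lambda>\<epsilon>. (1 / \<epsilon>) *\<^sub>R (\<integral>\<xi>. symbol A (x + \<epsilon> *\<^sub>R \<xi>) \<xi> v \<partial>sphere_measure 0 1))
    \<longlongrightarrow> measure lborel (ball (0 :: real^'n) 1) *\<^sub>R div_symbol A x v) (at_right 0)"
proof -
  let ?\<sigma> = "sphere_measure (0 :: real^'n) 1"
  have "((\<lambda>y. A j y v) has_derivative (\<lambda>h. frechet_derivative (A j) (at x) h v)) (at x)" for j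
    using bounded_linear.has_derivative[OF blinfun.bounded_linear_left[of v]
        d[of j, unfolded frechet_derivative_works]] .
  moreover have "continuous_on (ball x b) (\<lambda>y. A j y v)" for j
    by (intro continuous_intros A)
  ultimately have "((\<lambda>\<epsilon>. \<Sum>j\<in>UNIV. (1 / \<epsilon>) *\<^sub>R (\<integral>\<xi>. (\<xi> $ j) *\<^sub>R A j (x + \<epsilon> *\<^sub>R \<xi>) v \<partial>?\<sigma>))
      \<longlongrightarrow> (\<Sum>j\<in>UNIV. measure lborel (ball (0 :: real^'n) 1) *\<^sub>R frechet_derivative (A j) (at x) (axis j 1) v)) (at_right 0)"
    by (intro tendsto_sum unit_sphere_flux_tendsto_partial_derivative[OF _ b])
  moreover have "(\<Sum>j\<in>UNIV. measure lborel (ball (0 :: real^'n) 1) *\<^sub>R frechet_derivative (A j) (at x) (axis j 1) v)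
      = measure lborel (ball (0 :: real^'n) 1) *\<^sub>R div_symbol A x v"
    by (simp add: div_symbol_def partial_deriv_def blinfun.sum_left scaleR_sum_right)
  moreover have "\<forall>\<^sub>F \<epsilon> in at_right 0. (\<Sum>j\<in>UNIV. (1 / \<epsilon>) *\<^sub>R (\<integral>\<xi>. (\<xi> $ j) *\<^sub>R A j (x + \<epsilon> *\<^sub>R \<xi>) v \<partial>?\<sigma>))
      = (1 / \<epsilon>) *\<^sub>R (\<integral>\<xi>. symbol A (x + \<epsilon> *\<^sub>R \<xi>) \<xi> v \<partial>?\<sigma>)"
    unfolding eventually_at_right_field
  proof (intro exI[of _ b] conjI allI impI b)
    fix \<epsilon> :: real assume \<epsilon>: "0 < \<epsilon>" "\<epsilon> < b"
    have "continuous_on (sphere 0 1) (\<lambda>\<xi>. A j (x + \<epsilon> *\<^sub>R \<xi>))" for j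
      by (rule continuous_on_compose2[OF A]) (use \<epsilon> in \<open>auto intro!: continuous_intros simp: dist_norm\<close>)
    then have "(\<integral>\<xi>. (\<Sum>j\<in>UNIV. (\<xi> $ j) *\<^sub>R A j (x + \<epsilon> *\<^sub>R \<xi>) v) \<partial>?\<sigma>)
        = (\<Sum>j\<in>UNIV. (\<integral>\<xi>. (\<xi> $ j) *\<^sub>R A j (x + \<epsilon> *\<^sub>R \<xi>) v \<partial>?\<sigma>))"
      by (intro Bochner_Integration.integral_sum integrable_continuous_unit_sphere continuous_intros)
    then show "(\<Sum>j\<in>UNIV. (1 / \<epsilon>) *\<^sub>R (\<integral>\<xi>. (\<xi> $ j) *\<^sub>R A j (x + \<epsilon> *\<^sub>R \<xi>) v \<partial>?\<sigma>))
      = (1 / \<epsilon>) *\<^sub>R (\<integral>\<xi>. symbol A (x + \<epsilon> *\<^sub>R \<xi>) \<xi> v \<partial>?\<sigma>)"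
      by (simp add: symbol_def blinfun.sum_left blinfun.scaleR_left scaleR_sum_right)
  qed
  ultimately show ?thesis by (simp add: tendsto_cong)
qed

text \<open>Rescaling to the unit sphere and writing \<open>u (x + \<epsilon> \<xi>) = \<epsilon> w(\<xi>) + u x\<close> with the difference
  quotient \<open>w\<close>. The powers of \<open>\<epsilon>\<close> from the area of the sphere and the volume of the ball leave a
  factor \<open>1 / \<epsilon>\<close>, which cancels in front of \<open>w\<close> and remains in front of the constant \<open>u x\<close>.\<close>

lemma ball_average_flux_eq:
  fixes A :: "'n::finite \<Rightarrow> real^'n \<Rightarrow> 'e::euclidean_space \<Rightarrow>\<^sub>L 'f::euclidean_space"
  assumes A: "\<And>j. continuous_on (ball x b) (A j)" and \<epsilon>: "0 < \<epsilon>" "\<epsilon> < b"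
    and w: "integrable (sphere_measure 0 1) (\<lambda>\<xi>. (1 / \<epsilon>) *\<^sub>R (u (x + \<epsilon> *\<^sub>R \<xi>) - u x))"
  shows "(1 / measure lborel (ball x \<epsilon>)) *\<^sub>R
      (\<integral>y. symbol A y (outward_unit_normal x \<epsilon> y) (u y) \<partial>sphere_measure x \<epsilon>)
    = (1 / measure lborel (ball (0 :: real^'n) 1)) *\<^sub>R
      ((\<integral>\<xi>. symbol A (x + \<epsilon> *\<^sub>R \<xi>) \<xi> ((1 / \<epsilon>) *\<^sub>R (u (x + \<epsilon> *\<^sub>R \<xi>) - u x)) \<partial>sphere_measure 0 1)
       + (1 / \<epsilon>) *\<^sub>R (\<integral>\<xi>. symbol A (x + \<epsilon> *\<^sub>R \<xi>) \<xi> (u x) \<partial>sphere_measure 0 1))"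
proof -
  let ?\<sigma> = "sphere_measure (0 :: real^'n) 1"
  let ?\<omega> = "measure lborel (ball (0 :: real^'n) 1)"
  define W where "W = (\<lambda>\<xi>. (1 / \<epsilon>) *\<^sub>R (u (x + \<epsilon> *\<^sub>R \<xi>) - u x))"
  have intW: "integrable ?\<sigma> W" using w by (simp only: W_def)
  let ?S = "\<lambda>\<xi>. symbol A (x + \<epsilon> *\<^sub>R \<xi>) \<xi>"
  let ?K = "\<lambda>\<xi>. ?S (ball_retraction \<xi>)"
  interpret finite_measure ?\<sigma> by (rule finite_measure_unit_sphere)
  obtain B where K: "continuous_on UNIV ?K" "\<And>\<xi>. norm (?K \<xi>) \<le> B"
    using symbol_retraction_bcontfun[where A = A, OF A less_imp_le[OF \<epsilon>(1)] \<epsilon>(2)]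
    by (auto simp: bcontfun_def bounded_iff)
  have SK: "?K \<xi> = ?S \<xi>" if "\<xi> \<in> space ?\<sigma>" for \<xi> using that by (simp add: ball_retraction_sphere)
  have int: "integrable ?\<sigma> (\<lambda>\<xi>. ?S \<xi> (h \<xi>))" if "integrable ?\<sigma> h" for h
    using integrable_blinfun_apply[OF ident_measurable_sphere_measure K that]
    by (rule Bochner_Integration.integrable_cong[THEN iffD1, rotated 2]) (simp_all add: ball_retraction_sphere)
  have uw: "u (x + \<epsilon> *\<^sub>R \<xi>) = \<epsilon> *\<^sub>R W \<xi> + u x" for \<xi> using \<epsilon> by (simp add: W_def)
  have "integrable ?\<sigma> (\<lambda>\<xi>. \<epsilon> *\<^sub>R W \<xi> + u x)" 
    by (intro Bochner_Integration.integrable_add integrable_scaleR_right intW) simp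
  then have int_u: "integrable ?\<sigma> (\<lambda>\<xi>. ?S \<xi> (u (x + \<epsilon> *\<^sub>R \<xi>)))" by (intro int) (simp only: uw)
  let ?f = "\<lambda>y. symbol A y (outward_unit_normal x \<epsilon> y) (u y)"
  have f: "?f (x + \<epsilon> *\<^sub>R \<xi>) = ?S \<xi> (u (x + \<epsilon> *\<^sub>R \<xi>))" for \<xi>
    using \<epsilon> by (simp add: outward_unit_normal_def)
  have "(\<integral>y. ?f y \<partial>sphere_measure x \<epsilon>) = \<epsilon> ^ (CARD('n) - 1) *\<^sub>R (\<integral>\<xi>. ?S \<xi> (u (x + \<epsilon> *\<^sub>R \<xi>)) \<partial>?\<sigma>)"
    using integral_sphere_measure_similarity[OF lebesgue_isometry_id \<epsilon>(1) zero_less_one, of ?f x 0]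
      borel_measurable_integrable[OF int_u] by (simp only: f diff_zero mult_1_right)
  also have "(\<integral>\<xi>. ?S \<xi> (u (x + \<epsilon> *\<^sub>R \<xi>)) \<partial>?\<sigma>) = (\<integral>\<xi>. \<epsilon> *\<^sub>R ?S \<xi> (W \<xi>) + ?S \<xi> (u x) \<partial>?\<sigma>)"
    by (subst uw) (simp only: blinfun.add_right blinfun.scaleR_right)
  also have "\<dots> = \<epsilon> *\<^sub>R (\<integral>\<xi>. ?S \<xi> (W \<xi>) \<partial>?\<sigma>) + (\<integral>\<xi>. ?S \<xi> (u x) \<partial>?\<sigma>)"
    using int[OF intW] int[of "\<lambda>_. u x"]
    by (subst Bochner_Integration.integral_add) auto
  finally have I: "(\<integral>y. ?f y \<partial>sphere_measure x \<epsilon>) =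
      \<epsilon> ^ (CARD('n) - 1) *\<^sub>R (\<epsilon> *\<^sub>R (\<integral>\<xi>. ?S \<xi> (W \<xi>) \<partial>?\<sigma>) + (\<integral>\<xi>. ?S \<xi> (u x) \<partial>?\<sigma>))" .
  have vol: "measure lborel (ball x \<epsilon>) = ?\<omega> * \<epsilon> ^ CARD('n)"
    using \<epsilon> by (simp add: content_ball)
  have pw: "\<epsilon> ^ CARD('n) = \<epsilon> * \<epsilon> ^ (CARD('n) - 1)"
    by (metis zero_less_card_finite power_eq_if less_numeral_extra(3))
  have "1 / measure lborel (ball x \<epsilon>) * \<epsilon> ^ (CARD('n) - 1) = (1 / ?\<omega>) * (1 / \<epsilon>)"
    unfolding vol pw using \<epsilon> by simp
  then have "(1 / measure lborel (ball x \<epsilon>)) *\<^sub>R (\<integral>y. ?f y \<partial>sphere_measure x \<epsilon>)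
      = (1 / ?\<omega>) *\<^sub>R (1 / \<epsilon>) *\<^sub>R (\<epsilon> *\<^sub>R (\<integral>\<xi>. ?S \<xi> (W \<xi>) \<partial>?\<sigma>) + (\<integral>\<xi>. ?S \<xi> (u x) \<partial>?\<sigma>))"
    unfolding I by (simp only: scaleR_scaleR)
  also have "(1 / \<epsilon>) *\<^sub>R (\<epsilon> *\<^sub>R (\<integral>\<xi>. ?S \<xi> (W \<xi>) \<partial>?\<sigma>) + (\<integral>\<xi>. ?S \<xi> (u x) \<partial>?\<sigma>))
      = (\<integral>\<xi>. ?S \<xi> (W \<xi>) \<partial>?\<sigma>) + (1 / \<epsilon>) *\<^sub>R (\<integral>\<xi>. ?S \<xi> (u x) \<partial>?\<sigma>)"
    using \<epsilon> by (simp only: scaleR_add_right scaleR_scaleR) simp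
  finally show ?thesis unfolding W_def .
qed

theorem proposition6p2:
  fixes \<Omega> :: "(real^'n::finite) set"
    and A :: "'n \<Rightarrow> real^'n \<Rightarrow> 'e::euclidean_space \<Rightarrow>\<^sub>L 'f::euclidean_space"
    and B :: "real^'n \<Rightarrow> 'e \<Rightarrow>\<^sub>L 'f"
    and u u' :: "real^'n \<Rightarrow> 'e"
    and x :: "real^'n"
    and p :: real
  assumes "open \<Omega>" and "connected \<Omega>" and "bounded \<Omega>"
    and "1 < p"
    and "\<And>j. smooth_on \<Omega> (A j)" and "smooth_on \<Omega> B"
    and "elliptic_on \<Omega> A"
    and "in_W1p \<Omega> p u"
    and "x \<in> \<Omega>"
    and "weak_Lp_directional_deriv p u x u'"
  shows "((\<lambda>\<epsilon>. (1 / measure lborel (ball x \<epsilon>)) *\<^sub>R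
            (\<integral>y. symbol A y (outward_unit_normal x \<epsilon> y) (u y) \<partial>sphere_measure x \<epsilon>))
          \<longlongrightarrow>
          (1 / measure lborel (ball (0 :: real^'n) 1)) *\<^sub>R
            (\<integral>\<xi>. symbol A x \<xi> (u' \<xi>) \<partial>sphere_measure 0 1)
          + div_symbol A x (u x))
         (at_right 0)"
proof -
  let ?\<sigma> = "sphere_measure (0 :: real^'n) 1"
  let ?\<omega> = "measure lborel (ball (0 :: real^'n) 1)"
  let ?w = "\<lambda>\<epsilon> \<xi>. (1 / \<epsilon>) *\<^sub>R (u (x + \<epsilon> *\<^sub>R \<xi>) - u x)"
  have weak: "weakly_tendsto_Lp ?\<sigma> p ?w u' (at_right 0)"
    using assms(10) by (simp add: weak_Lp_directional_deriv_def)
  obtain b where b: "0 < b" "ball x b \<subseteq> \<Omega>"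
    using assms(1,9) by (meson openE)
  have contA: "continuous_on (ball x b) (A j)" for j
    using smooth_on_imp_continuous_on[OF assms(5)] b(2) by (rule continuous_on_subset)
  have diffA: "A j differentiable (at x)" for j
    by (rule smooth_on_imp_differentiable[OF assms(5,9)])
  have "((\<lambda>\<epsilon>. (1 / ?\<omega>) *\<^sub>R ((\<integral>\<xi>. symbol A (x + \<epsilon> *\<^sub>R \<xi>) \<xi> (?w \<epsilon> \<xi>) \<partial>?\<sigma>)
        + (1 / \<epsilon>) *\<^sub>R (\<integral>\<xi>. symbol A (x + \<epsilon> *\<^sub>R \<xi>) \<xi> (u x) \<partial>?\<sigma>)))
      \<longlongrightarrow> (1 / ?\<omega>) *\<^sub>R ((\<integral>\<xi>. symbol A x \<xi> (u' \<xi>) \<partial>?\<sigma>) + ?\<omega> *\<^sub>R div_symbol A x (u x))) (at_right 0)"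
    by (intro tendsto_scaleR[OF tendsto_const] tendsto_add
        symbol_integral_weak_tendsto[OF b(1) contA assms(4) weak]
        symbol_flux_tendsto_div_symbol[OF b(1) contA diffA])
  moreover have "(1 / ?\<omega>) *\<^sub>R ((\<integral>\<xi>. symbol A x \<xi> (u' \<xi>) \<partial>?\<sigma>) + ?\<omega> *\<^sub>R div_symbol A x (u x))
      = (1 / ?\<omega>) *\<^sub>R (\<integral>\<xi>. symbol A x \<xi> (u' \<xi>) \<partial>?\<sigma>) + div_symbol A x (u x)"
    by (simp add: scaleR_add_right)
  moreover have "\<forall>\<^sub>F \<epsilon> in at_right 0.
      (1 / ?\<omega>) *\<^sub>R ((\<integral>\<xi>. symbol A (x + \<epsilon> *\<^sub>R \<xi>) \<xi> (?w \<epsilon> \<xi>) \<partial>?\<sigma>)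
        + (1 / \<epsilon>) *\<^sub>R (\<integral>\<xi>. symbol A (x + \<epsilon> *\<^sub>R \<xi>) \<xi> (u x) \<partial>?\<sigma>))
      = (1 / measure lborel (ball x \<epsilon>)) *\<^sub>R
            (\<integral>y. symbol A y (outward_unit_normal x \<epsilon> y) (u y) \<partial>sphere_measure x \<epsilon>)"
  proof -
    have "\<forall>\<^sub>F \<epsilon> in at_right 0. in_Lp ?\<sigma> p (?w \<epsilon>)"
      using weak by (simp add: weakly_tendsto_Lp_def)
    moreover have "\<forall>\<^sub>F \<epsilon> in at_right 0. 0 < \<epsilon> \<and> \<epsilon> < b"
      using b(1) unfolding eventually_at_right_field by blast
    ultimately show ?thesis
    proof eventually_elim
      case (elim \<epsilon>)
      then have "integrable ?\<sigma> (?w \<epsilon>)"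
        using assms(4) by (intro in_Lp_imp_integrable[OF finite_measure_unit_sphere]) auto
      from ball_average_flux_eq[OF contA _ _ this] elim show ?case by simp
    qed
  qed
  ultimately show ?thesis by (simp only: tendsto_cong)
qed

end
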